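(* Let $G$ be a $3$-connected trivalent graph with $2g-2$ vertices, $C_G\subset\mathbb{P}^{g-1}$ its graph curve, and $M_G$ the matroid of the configuration $X_G=H\cap C_G$ for a generic hyperplane $H$. Then $M_G$ is self-dual, and $M_G$ depends only on the graph $G$ (not on the choice of the generic hyperplane or of the realization of $C_G$).
   Context: Let $G$ be a $3$-connected trivalent graph with $2g-2$ vertices and $3g-3$ edges. Orient its edges and let $\mathrm{Cyc}_G$ be a $g\times(3g-3)$ matrix whose rows span the cycle space of $G$; its columns give points in $\mathbb{P}^{g-1}$ indexed by edges. For each vertex $v$, the three columns indexed by edges at $v$ span a line $L_v$, and the graph curve $C_G$ is the union of these $2g-2$ lines (the stable canonical curve with dual graph $G$). For a generic hyperplane $H\cong\mathbb{P}^{g-2}$, $X_G$ consists of the $2g-2$ distinct points $p_v=L_v\cap H$, and $M_G$ is the rank $g-1$ matroid on the vertices of $G$ given by linear dependence among the $p_v$. A matroid of rank $n$ on $2n$ elements is self-dual if an $n$-set is a basis exactly when its complement is a basis. *)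

theory Defs
  imports "HOL-Analysis.Cartesian_Space"
begin

section \<open>Graphs\<close>

text \<open>A finite graph has vertex type \<^typ>\<open>'v\<close>, edge type \<^typ>\<open>'e\<close> and an end-point map; parallel
  edges are not excluded here (for trivalent graphs, \<open>three_connected\<close> below excludes them).\<close>

definition graph :: "('e::finite \<Rightarrow> 'v::finite set) \<Rightarrow> bool" where
  "graph ends \<longleftrightarrow> (\<forall>e. card (ends e) = 2)"

definition trivalent :: "('e::finite \<Rightarrow> 'v::finite set) \<Rightarrow> bool" where
  "trivalent ends \<longleftrightarrow> (\<forall>v. card {e. v \<in> ends e} = 3)"

definition connected_without :: "('e::finite \<Rightarrow> 'v::finite set) \<Rightarrow> 'v set \<Rightarrow> bool" where
  "connected_without ends S \<longleftrightarrow>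
     (\<forall>u w. u \<notin> S \<longrightarrow> w \<notin> S \<longrightarrow> (u, w) \<in> {(a, b). a \<notin> S \<and> b \<notin> S \<and> (\<exists>e. ends e = {a, b})}\<^sup>*)"

definition three_connected :: "('e::finite \<Rightarrow> 'v::finite set) \<Rightarrow> bool" where
  "three_connected ends \<longleftrightarrow>
     CARD('v) > 3 \<and> (\<forall>S. card S < 3 \<longrightarrow> connected_without ends S)"

definition orientation ::
  "('e::finite \<Rightarrow> 'v::finite set) \<Rightarrow> ('e \<Rightarrow> 'v) \<Rightarrow> ('e \<Rightarrow> 'v) \<Rightarrow> bool" where
  "orientation ends tail head \<longleftrightarrow> (\<forall>e. ends e = {tail e, head e})"

definition incidence_matrix ::
  "('e::finite \<Rightarrow> 'v::finite) \<Rightarrow> ('e \<Rightarrow> 'v) \<Rightarrow> 'k::field ^ 'e ^ 'v" where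
  "incidence_matrix tail head =
     (\<chi> v e. (if head e = v then 1 else 0) - (if tail e = v then 1 else 0))"

definition cycle_space ::
  "('e::finite \<Rightarrow> 'v::finite) \<Rightarrow> ('e \<Rightarrow> 'v) \<Rightarrow> ('k::field ^ 'e) set" where
  "cycle_space tail head = {x. incidence_matrix tail head *v x = 0}"

definition cycle_matrix :: "('e::finite \<Rightarrow> 'v::finite set) \<Rightarrow> 'k::field ^ 'e ^ 'g::finite \<Rightarrow> bool" where
  "cycle_matrix ends Cyc \<longleftrightarrow>
     (\<exists>tail head. orientation ends tail head \<and> vec.span (rows Cyc) = cycle_space tail head)"

section \<open>Graph curves and their hyperplane sections\<close>

text \<open>Linear subspaces of projective space are represented by the corresponding linear subspaces
  of the underlying vector space: a point is a subspace of dimension 1, a line one of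
  dimension 2.\<close>

definition graph_curve_line ::
  "('e::finite \<Rightarrow> 'v::finite set) \<Rightarrow> 'k::field ^ 'e ^ 'g::finite \<Rightarrow> 'v \<Rightarrow> ('k ^ 'g) set" where
  "graph_curve_line ends Cyc v = vec.span {column e Cyc |e. v \<in> ends e}"

definition hyperplane :: "'k::field ^ 'n::finite \<Rightarrow> ('k ^ 'n) set" where
  "hyperplane h = {x. (\<Sum>i\<in>UNIV. h $ i * x $ i) = 0}"

definition section_point ::
  "('e::finite \<Rightarrow> 'v::finite set) \<Rightarrow> 'k::field ^ 'e ^ 'g::finite \<Rightarrow> ('k ^ 'g) set \<Rightarrow> 'v
     \<Rightarrow> ('k ^ 'g) set" where
  "section_point ends Cyc H v = graph_curve_line ends Cyc v \<inter> H"

definition distinct_points :: "('v \<Rightarrow> ('k::field ^ 'n::finite) set) \<Rightarrow> bool" where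
  "distinct_points p \<longleftrightarrow> (\<forall>v. vec.subspace (p v) \<and> vec.dim (p v) = 1) \<and> inj p"

text \<open>The independent sets of the matroid of a point configuration. As the points \<open>p v\<close> are
  one-dimensional, the dimension condition says that representatives of the points in \<open>A\<close>
  form a linearly independent family.\<close>

definition point_matroid :: "('v::finite \<Rightarrow> ('k::field ^ 'n::finite) set) \<Rightarrow> 'v set set" where
  "point_matroid p = {A. vec.dim (\<Union>v\<in>A. p v) = card A}"

section \<open>Genericity\<close>

inductive polynomial_map :: "('k::field ^ 'n::finite \<Rightarrow> 'k) \<Rightarrow> bool" where
  const: "polynomial_map (\<lambda>x. c)"
| coord: "polynomial_map (\<lambda>x. x $ i)"
| add: "polynomial_map f \<Longrightarrow> polynomial_map g \<Longrightarrow> polynomial_map (\<lambda>x. f x + g x)"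
| mult: "polynomial_map f \<Longrightarrow> polynomial_map g \<Longrightarrow> polynomial_map (\<lambda>x. f x * g x)"

definition zariski_open :: "('k::field ^ 'n::finite) set \<Rightarrow> bool" where
  "zariski_open U \<longleftrightarrow>
     (\<exists>F. (\<forall>f\<in>F. polynomial_map f) \<and> U = {x. \<exists>f\<in>F. f x \<noteq> 0})"

text \<open>A generic hyperplane is one from some nonempty Zariski open set of the dual projective space.
  We work in the affine cone without the origin; this is no different, since
  the union of all nonzero multiples of an open set of coefficient vectors is again open and
  defines the same hyperplanes.\<close>

definition for_generic_hyperplane :: "(('k::field ^ 'n::finite) set \<Rightarrow> bool) \<Rightarrow> bool" where
  "for_generic_hyperplane P \<longleftrightarrow>
     (\<exists>U. zariski_open U \<and> U \<noteq> {} \<and> (\<forall>h\<in>U. h \<noteq> 0 \<and> P (hyperplane h)))"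

section \<open>Matroids\<close>

definition matroid :: "'a set \<Rightarrow> 'a set set \<Rightarrow> bool" where
  "matroid S I \<longleftrightarrow> finite S \<and> I \<subseteq> Pow S \<and> {} \<in> I \<and> (\<forall>A\<in>I. \<forall>B\<subseteq>A. B \<in> I) \<and>
     (\<forall>A\<in>I. \<forall>B\<in>I. card A < card B \<longrightarrow> (\<exists>x\<in>B - A. insert x A \<in> I))"

definition matroid_basis :: "'a set set \<Rightarrow> 'a set \<Rightarrow> bool" where
  "matroid_basis I B \<longleftrightarrow> B \<in> I \<and> (\<forall>A\<in>I. B \<subseteq> A \<longrightarrow> A = B)"

definition matroid_rank :: "'a set set \<Rightarrow> nat" where
  "matroid_rank I = Max (card ` I)"

definition self_dual_matroid :: "nat \<Rightarrow> 'a set \<Rightarrow> 'a set set \<Rightarrow> bool" where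
  "self_dual_matroid n S I \<longleftrightarrow> matroid S I \<and> matroid_rank I = n \<and> card S = 2 * n \<and>
     (\<forall>B\<subseteq>S. card B = n \<longrightarrow> (matroid_basis I B \<longleftrightarrow> matroid_basis I (S - B)))"

end

theory Submission
  imports Defs "HOL-Analysis.Determinants" "HOL-Computational_Algebra.Polynomial"
begin

text \<open>A linear functional on the ambient space of the graph curve is the same as a flow on the graph.
  If the hyperplane is given by a flow \<open>y\<close> without zeros, then \<open>p\<^sub>v\<close>, evaluated at a flow \<open>z\<close>, is the
  \<open>2 \<times> 2\<close> determinant of \<open>y\<close> and \<open>z\<close> on two of the edges at \<open>v\<close>. This description involves only the
  cycle space, so the generic matroid depends only on the graph (over the given field).

  For self-duality let \<open>\<lambda>\<^sub>v\<close> be the inverse of the product of the three signed values of \<open>y\<close> at \<open>v\<close>.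
  Up to sign, \<open>\<lambda>\<^sub>v p\<^sub>v(z) p\<^sub>v(w)\<close> is the signed sum of \<open>z\<^sub>e w\<^sub>e / y\<^sub>e\<close> over the edges \<open>e\<close> at \<open>v\<close>, and in the sum
  over all \<open>v\<close> the two contributions of every edge cancel. Hence the bilinear form \<open>\<Sum>\<^sub>v \<lambda>\<^sub>v p\<^sub>v \<otimes> p\<^sub>v\<close>
  vanishes. If the \<open>p\<^sub>v\<close> with \<open>v \<in> A\<close> form a basis of the hyperplane and \<open>w\<close> annihilates the other
  points, then the relation \<open>\<Sum>\<^sub>v \<lambda>\<^sub>v p\<^sub>v(w) p\<^sub>v = 0\<close> forces \<open>w\<close> to annihilate all of them. As the graph is
  connected, \<open>w\<close> is then a multiple of \<open>y\<close>, so the points outside \<open>A\<close> span the hyperplane.\<close>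

section \<open>Linear algebra over a field\<close>

text \<open>A basis \<open>B\<close> of the kernel extends to a basis \<open>E\<close> of the whole
  space, and \<open>f\<close> maps the remaining vectors \<open>C = E - B\<close> injectively onto a
  basis of the range.\<close>

lemma rank_nullity_vec:
  fixes f :: "'k::field ^ 'm::finite \<Rightarrow> 'k ^ 'n::finite"
  assumes f: "Vector_Spaces.linear (*s) (*s) f"
  shows "vec.dim (range f) + vec.dim {x. f x = 0} = CARD('m)"
proof -
  interpret f: Vector_Spaces.linear "(*s)" "(*s)" f by (fact f)
  let ?K = "{x. f x = 0}"
  obtain B where B: "B \<subseteq> ?K" "vec.independent B" "?K \<subseteq> vec.span B" "card B = vec.dim ?K"
    using vec.basis_exists[of ?K] by auto
  define E where "E = vec.extend_basis B"
  have BE: "B \<subseteq> E" and E: "vec.independent E" "vec.span E = UNIV"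
    using B(2) by (auto simp: E_def vec.extend_basis_superset vec.independent_extend_basis)
  define C where "C = E - B"
  have finE: "finite E" using E(1) vec.finiteI_independent by blast
  have C: "vec.independent C" using E(1) unfolding C_def by (rule vec.independent_mono) auto
  have inj: "inj_on f (vec.span C)"
  proof (subst f.inj_on_iff_eq_0[OF vec.subspace_span], intro ballI impI)
    fix x assume x: "x \<in> vec.span C" "f x = 0"
    \<comment> \<open>\<open>x\<close> lies in the spans of the disjoint sets \<open>B\<close> and
      \<open>C\<close>, so its coordinates with respect to \<open>E\<close> are supported in both
      sets and hence vanish.\<close>
    have xB: "x \<in> vec.span B" using x B(3) by auto
    have rC: "vec.representation E x = vec.representation C x"
      by (rule vec.representation_extend[OF E(1) x(1)]) (auto simp: C_def)
    have rB: "vec.representation E x = vec.representation B x"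
      by (rule vec.representation_extend[OF E(1) xB BE])
    have "vec.representation E x b = 0" for b
      using vec.representation_ne_zero[of C x b] vec.representation_ne_zero[of B x b] rB rC
      by (auto simp: C_def)
    moreover have "(\<Sum>b | vec.representation E x b \<noteq> 0. vec.representation E x b *s b) = x"
      using E by (intro vec.sum_nonzero_representation_eq) auto
    ultimately show "x = 0" by simp
  qed
  have "range f = vec.span (f ` E)" using E(2) f.span_image by metis
  also have "\<dots> = vec.span (f ` C)"
  proof (subst vec.span_eq, intro conjI subsetI)
    fix y assume "y \<in> f ` E"
    then obtain e where e: "e \<in> E" "y = f e" by auto
    show "y \<in> vec.span (f ` C)"
    proof (cases "e \<in> B")
      case True
      then have "y = 0" using B(1) e by auto
      then show ?thesis by (simp add: vec.span_zero)
    next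
      case False then show ?thesis using e by (auto simp: C_def intro: vec.span_base)
    qed
  next
    fix y assume "y \<in> f ` C" then show "y \<in> vec.span (f ` E)"
      by (auto simp: C_def intro: vec.span_base)
  qed
  finally have "vec.dim (range f) = vec.dim (f ` C)" by simp
  also have "\<dots> = vec.dim C" using f inj by (rule vec.dim_image_eq)
  also have "\<dots> = card C" using C by (rule vec.dim_eq_card_independent)
  finally have "vec.dim (range f) + vec.dim ?K = card C + card B" using B(4) by simp
  also have "\<dots> = card E" unfolding C_def
    using finE BE by (metis card_Diff_subset card_mono finite_subset le_add_diff_inverse2)
  also have "\<dots> = CARD('m)"
    using vec.dim_eq_card_independent[OF E(1)] E(2) vec_dim_card by (metis vec.dim_span)
  finally show ?thesis .
qed

text \<open>The first argument plays the role of a linear functional on the ambient space.\<close>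

definition dotp :: "'k::field ^ 'n::finite \<Rightarrow> 'k ^ 'n \<Rightarrow> 'k" where
  "dotp h x = (\<Sum>i\<in>UNIV. h $ i * x $ i)"

lemma dotp_simps:
  "dotp h 0 = 0" "dotp h (x + y) = dotp h x + dotp h y" "dotp h (c *s x) = c * dotp h x"
  "dotp h (x - y) = dotp h x - dotp h y"
  by (simp_all add: dotp_def sum.distrib algebra_simps sum_distrib_left sum_subtractf)

lemma dotp_sum: "dotp h (\<Sum>a\<in>A. f a) = (\<Sum>a\<in>A. dotp h (f a))"
  by (induction A rule: infinite_finite_induct) (auto simp: dotp_simps)

lemma dotp_scale_left: "dotp (c *s h) x = c * dotp h x"
  by (simp add: dotp_def sum_distrib_left ac_simps)

lemma dotp_axis: "dotp h (axis i 1) = h $ i"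
  by (simp add: dotp_def axis_def if_distrib[of "\<lambda>a. _ * a"] cong: if_cong)

lemma dotp_eq_0_iff: "x = 0 \<longleftrightarrow> (\<forall>w. dotp w x = 0)"
proof
  assume *: "\<forall>w. dotp w x = 0"
  have "dotp (axis i 1) x = x $ i" for i
    by (simp add: dotp_def axis_def if_distrib[of "\<lambda>a. a * _"] cong: if_cong)
  then show "x = 0" using * by (simp add: vec_eq_iff)
qed (simp add: dotp_simps)

lemma hyperplane_dotp: "hyperplane h = {x. dotp h x = 0}"
  by (simp add: hyperplane_def dotp_def)

lemma dim_hyperplane:
  fixes h :: "'k::field ^ 'n::finite"
  assumes "h \<noteq> 0"
  shows "vec.dim (hyperplane h) = CARD('n) - 1"
proof -
  \<comment> \<open>The functional is read as a map to a one-dimensional space so that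
    \<open>rank_nullity_vec\<close> applies.\<close>
  define f :: "'k ^ 'n \<Rightarrow> 'k ^ 1" where "f x = (\<chi> i. dotp h x)" for x
  have lin: "Vector_Spaces.linear (*s) (*s) f"
    by unfold_locales (auto simp: f_def vec_eq_iff dotp_simps)
  obtain i where i: "h $ i \<noteq> 0" using assms by (auto simp: vec_eq_iff)
  have "range f = UNIV"
  proof (rule surjI)
    fix z :: "'k ^ 1"
    show "f ((z $ 1 / h $ i) *s axis i 1) = z"
      using i by (simp add: f_def vec_eq_iff dotp_simps dotp_axis)
  qed
  moreover have "vec.dim (UNIV :: ('k ^ 1) set) = 1" by (simp only: vec_dim_card card_UNIV_unit num1_eq1) simp
  moreover have "{x. f x = 0} = hyperplane h"
    by (auto simp: f_def hyperplane_dotp vec_eq_iff)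
  ultimately show ?thesis using rank_nullity_vec[OF lin] by simp
qed

text \<open>A basis of the span of \<open>S\<close> stays independent when \<open>x\<close> is
  added, so some linear map is 1 at \<open>x\<close> and 0 on \<open>S\<close>; its values on the
  standard basis are the coordinates of \<open>w\<close>.\<close>

lemma dotp_separates_span:
  fixes x :: "'k::field ^ 'n::finite"
  assumes "x \<notin> vec.span S"
  shows "\<exists>w. dotp w x = 1 \<and> (\<forall>s\<in>S. dotp w s = 0)"
proof -
  obtain B where B: "B \<subseteq> S" "vec.independent B" "S \<subseteq> vec.span B" "card B = vec.dim S"
    by (rule vec.basis_exists[of S])
  have xB: "x \<notin> vec.span B" using assms vec.span_mono[OF B(1)] by auto
  then have ind: "vec.independent (insert x B)" using B(2) vec.independent_insertI by blast
  obtain F :: "'k ^ 'n \<Rightarrow> 'k ^ 1" where F: "Vector_Spaces.linear (*s) (*s) F"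
    "\<forall>b\<in>insert x B. F b = (if b = x then 1 else 0)"
    using vec.linear_independent_extend[OF ind, of "\<lambda>b. if b = x then 1 else 0"] by blast
  interpret F: Vector_Spaces.linear "(*s)" "(*s)" F by (fact F(1))
  define w where "w = (\<chi> i. F (axis i 1) $ 1)"
  have w: "dotp w y = F y $ 1" for y
  proof -
    have "F y = F (\<Sum>i\<in>UNIV. y $ i *s axis i 1)" by (simp add: basis_expansion)
    also have "\<dots> = (\<Sum>i\<in>UNIV. y $ i *s F (axis i 1))" by (simp add: F.sum F.scale)
    finally show ?thesis by (simp add: dotp_def w_def mult.commute)
  qed
  have "x \<notin> B" using xB vec.span_base by blast
  then have "F b = 0" if "b \<in> B" for b using F(2) that by auto
  then have "F s = 0" if "s \<in> S" for s
    using F.eq_0_on_span[of B s] B(3) that by auto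
  moreover have "F x = 1" using F(2) by auto
  ultimately show ?thesis using w by (intro exI[of _ w]) auto
qed

text \<open>Indexed families rather than sets: equal vectors at two indices count as dependent, in
  agreement with \<open>card A\<close> in \<open>point_matroid\<close>.\<close>

definition indep_family :: "('v::finite \<Rightarrow> 'k::field ^ 'n::finite) \<Rightarrow> 'v set \<Rightarrow> bool" where
  "indep_family q A \<longleftrightarrow> (\<forall>c. (\<Sum>v\<in>A. c v *s q v) = 0 \<longrightarrow> (\<forall>v\<in>A. c v = 0))"

lemma indep_family_iff:
  fixes q :: "'v::finite \<Rightarrow> 'k::field ^ 'n::finite"
  shows "indep_family q A \<longleftrightarrow> inj_on q A \<and> vec.independent (q ` A)"
proof
  assume L: "indep_family q A"
  have inj: "inj_on q A"
  proof (rule inj_onI, rule ccontr)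
    fix u v assume uv: "u \<in> A" "v \<in> A" "q u = q v" "u \<noteq> v"
    let ?c = "\<lambda>x. (if x = u then 1 else 0) - (if x = v then 1 else 0) :: 'k"
    have "(\<Sum>x\<in>A. ?c x *s q x)
        = (\<Sum>x\<in>A. if x = u then q x else 0) - (\<Sum>x\<in>A. if x = v then q x else 0)"
      unfolding sum_subtractf[symmetric] by (rule sum.cong) auto
    also have "\<dots> = 0" using uv by simp
    finally have "?c u = 0" using spec[OF L[unfolded indep_family_def], of ?c] uv by blast
    then show False using uv by simp
  qed
  moreover have "vec.independent (q ` A)"
  proof (rule vec.independent_if_scalars_zero)
    fix c x assume s: "(\<Sum>x\<in>q ` A. c x *s x) = 0" and x: "x \<in> q ` A"
    have "(\<Sum>v\<in>A. c (q v) *s q v) = 0" using s by (simp add: sum.reindex[OF inj])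
    then have "\<forall>v\<in>A. c (q v) = 0" using L[unfolded indep_family_def, rule_format, of "c \<circ> q"] by auto
    then show "c x = 0" using x by auto
  qed simp
  ultimately show "inj_on q A \<and> vec.independent (q ` A)" by blast
next
  assume R: "inj_on q A \<and> vec.independent (q ` A)"
  show "indep_family q A" unfolding indep_family_def
  proof (intro allI impI ballI)
    fix c v assume s: "(\<Sum>v\<in>A. c v *s q v) = 0" and v: "v \<in> A"
    let ?c = "\<lambda>x. c (inv_into A q x)"
    have "(\<Sum>x\<in>q ` A. ?c x *s x) = (\<Sum>v\<in>A. c v *s q v)"
      using R by (simp add: sum.reindex)
    then have "?c (q v) = 0"
      using R s v vec.independentD[of "q ` A" "q ` A" ?c "q v"] by auto
    then show "c v = 0" using R v by simp
  qed
qed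

lemma indep_family_iff_dim: "indep_family q A \<longleftrightarrow> vec.dim (q ` A) = card A"
proof
  assume "indep_family q A" then show "vec.dim (q ` A) = card A"
    by (simp add: indep_family_iff card_image vec.dim_eq_card_independent)
next
  assume d: "vec.dim (q ` A) = card A"
  have "vec.dim (q ` A) \<le> card (q ` A)" by (simp add: vec.dim_le_card vec.span_superset)
  then have c: "card (q ` A) = card A" using card_image_le[of A q] d by simp
  then have "inj_on q A" by (simp add: eq_card_imp_inj_on)
  moreover have "vec.independent (q ` A)"
    using c d by (intro vec.card_le_dim_spanning[of "q ` A" "q ` A"]) (auto intro: vec.span_base)
  ultimately show "indep_family q A" by (simp add: indep_family_iff)
qed

lemma point_matroid_span:
  fixes q :: "'v::finite \<Rightarrow> 'k::field ^ 'n::finite"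
  shows "point_matroid (\<lambda>v. vec.span {q v}) = {A. indep_family q A}"
proof -
  have "vec.span (\<Union>v\<in>A. vec.span {q v}) = vec.span (q ` A)" for A
    unfolding vec.span_eq
  proof (intro conjI subsetI)
    fix x assume "x \<in> (\<Union>v\<in>A. vec.span {q v})"
    then obtain v where "v \<in> A" "x \<in> vec.span {q v}" by auto
    then show "x \<in> vec.span (q ` A)" using vec.span_mono[of "{q v}" "q ` A"] by auto
  qed (auto intro!: vec.span_base)
  then have "vec.dim (\<Union>v\<in>A. vec.span {q v}) = vec.dim (q ` A)" for A
    by (metis vec.dim_span)
  then show ?thesis by (simp add: point_matroid_def indep_family_iff_dim)
qed

text \<open>Exchange holds because a larger independent family has larger dimension and cannot lie
  in the span of the smaller one.\<close>

lemma matroid_indep_family: "matroid UNIV {A. indep_family q A}"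
  unfolding matroid_def
proof (intro conjI ballI allI impI)
  show "{} \<in> {A. indep_family q A}" by (simp add: indep_family_def)
next
  fix A B assume "A \<in> {A. indep_family q A}" "B \<subseteq> A"
  then show "B \<in> {A. indep_family q A}"
    using vec.independent_mono[of "q ` A" "q ` B"] by (auto simp: indep_family_iff intro: inj_on_subset)
next
  fix A B assume A: "A \<in> {A. indep_family q A}" and B: "B \<in> {A. indep_family q A}"
    and c: "card A < card B"
  have "\<not> q ` B \<subseteq> vec.span (q ` A)"
  proof
    assume "q ` B \<subseteq> vec.span (q ` A)"
    then have "vec.dim (q ` B) \<le> vec.dim (q ` A)" by (rule vec.dim_mono)
    then show False using A B c by (simp add: indep_family_iff_dim)
  qed
  then obtain x where x: "x \<in> B" "q x \<notin> vec.span (q ` A)" by auto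
  then have "q x \<notin> q ` A" using vec.span_base by blast
  then have "insert x A \<in> {A. indep_family q A}" "x \<notin> A"
    using A x by (auto simp: indep_family_iff vec.independent_insertI)
  then show "\<exists>x\<in>B - A. insert x A \<in> {A. indep_family q A}" using x by blast
qed auto

section \<open>Polynomial maps\<close>

lemma polynomial_map_sum:
  "(\<And>a. a \<in> A \<Longrightarrow> polynomial_map (f a)) \<Longrightarrow> polynomial_map (\<lambda>x. \<Sum>a\<in>A. f a x)"
  by (induction A rule: infinite_finite_induct)
    (auto intro: polynomial_map.const polynomial_map.add)

lemma polynomial_map_prod:
  "(\<And>a. a \<in> A \<Longrightarrow> polynomial_map (f a)) \<Longrightarrow> polynomial_map (\<lambda>x. \<Prod>a\<in>A. f a x)"
  by (induction A rule: infinite_finite_induct)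
    (auto intro: polynomial_map.const polynomial_map.mult)

lemma polynomial_map_det:
  fixes N :: "'k::field ^ 'n::finite \<Rightarrow> 'k ^ 'm::finite ^ 'm"
  assumes "\<And>i j. polynomial_map (\<lambda>x. N x $ i $ j)"
  shows "polynomial_map (\<lambda>x. det (N x))"
  unfolding det_def
  by (intro polynomial_map_sum polynomial_map.mult polynomial_map.const polynomial_map_prod assms)

text \<open>Restriction to a line reduces questions about zeros to polynomials in one
  variable.\<close>

lemma polynomial_map_on_line:
  fixes f :: "'k::field ^ 'n::finite \<Rightarrow> 'k"
  assumes "polynomial_map f"
  shows "\<exists>p. \<forall>t. f (a + t *s b) = poly p t"
  using assms
proof induction
  case (const c)
  then show ?case by (intro exI[of _ "[:c:]"]) simp
next
  case (coord i)
  then show ?case by (intro exI[of _ "[:a $ i, b $ i:]"]) simp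
next
  case (add f g)
  then show ?case by (metis poly_add)
next
  case (mult f g)
  then show ?case by (metis poly_mult)
qed

text \<open>On the line through \<open>a\<close> and \<open>b\<close> both restrictions are nonzero
  polynomials, so their product has finitely many roots, and an infinite field contains a
  non-root.\<close>

lemma polynomial_maps_common_nonzero:
  fixes f g :: "'k::field ^ 'n::finite \<Rightarrow> 'k"
  assumes inf: "infinite (UNIV :: 'k set)"
    and f: "polynomial_map f" "f a \<noteq> 0" and g: "polynomial_map g" "g b \<noteq> 0"
  shows "\<exists>x. f x \<noteq> 0 \<and> g x \<noteq> 0"
proof -
  obtain p where p: "\<And>t. f (a + t *s (b - a)) = poly p t"
    using polynomial_map_on_line[OF f(1)] by blast
  obtain r where r: "\<And>t. g (a + t *s (b - a)) = poly r t"
    using polynomial_map_on_line[OF g(1)] by blast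
  \<comment> \<open>The parameters 0 and 1 correspond to the points \<open>a\<close> and
    \<open>b\<close>.\<close>
  have "p \<noteq> 0" using p[of 0] f by auto
  moreover have "r \<noteq> 0" using r[of 1] g by auto
  ultimately have "finite {t. poly (p * r) t = 0}" by (intro poly_roots_finite) simp
  then obtain t where "poly (p * r) t \<noteq> 0" using inf by (metis (mono_tags) UNIV_eq_I mem_Collect_eq)
  then show ?thesis using p[of t] r[of t] by (metis mult_eq_0_iff poly_mult)
qed

lemma polynomial_maps_prod_nonzero:
  fixes f :: "'a \<Rightarrow> 'k::field ^ 'n::finite \<Rightarrow> 'k"
  assumes inf: "infinite (UNIV :: 'k set)" and "finite I"
    and "\<And>i. i \<in> I \<Longrightarrow> polynomial_map (f i)" and "\<And>i. i \<in> I \<Longrightarrow> \<exists>x. f i x \<noteq> 0"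
  shows "\<exists>x. (\<Prod>i\<in>I. f i x) \<noteq> 0"
  using assms(2-)
proof (induction I rule: finite_induct)
  case (insert i I)
  obtain a where a: "(\<Prod>i\<in>I. f i a) \<noteq> 0" using insert.IH insert.prems by auto
  obtain b where b: "f i b \<noteq> 0" using insert.prems(2)[of i] by auto
  have "polynomial_map (\<lambda>x. \<Prod>i\<in>I. f i x)" "polynomial_map (f i)"
    using insert.prems(1) by (auto intro: polynomial_map_prod)
  from polynomial_maps_common_nonzero[OF inf this(2) b this(1) a]
  obtain x where "f i x \<noteq> 0 \<and> (\<Prod>i\<in>I. f i x) \<noteq> 0" ..
  then have "(\<Prod>i\<in>insert i I. f i x) \<noteq> 0" using insert.hyps by simp
  then show ?case ..
qed simp

text \<open>Two nonempty Zariski open sets meet over an infinite field. This makes a matroid that is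
  attained generically unique.\<close>

lemma for_generic_hyperplane_common:
  fixes P Q :: "('k::field ^ 'n::finite) set \<Rightarrow> bool"
  assumes inf: "infinite (UNIV :: 'k set)"
    and "for_generic_hyperplane P" "for_generic_hyperplane Q"
  shows "\<exists>H. P H \<and> Q H"
proof -
  obtain U where U: "zariski_open U" "U \<noteq> {}" "\<forall>h\<in>U. h \<noteq> 0 \<and> P (hyperplane h)"
    using assms(2) unfolding for_generic_hyperplane_def by (elim exE conjE)
  obtain V where V: "zariski_open V" "V \<noteq> {}" "\<forall>h\<in>V. h \<noteq> 0 \<and> Q (hyperplane h)"
    using assms(3) unfolding for_generic_hyperplane_def by (elim exE conjE)
  obtain F where F: "\<forall>f\<in>F. polynomial_map f" "U = {x. \<exists>f\<in>F. f x \<noteq> 0}"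
    using U(1) unfolding zariski_open_def by (elim exE conjE)
  obtain G where G: "\<forall>f\<in>G. polynomial_map f" "V = {x. \<exists>f\<in>G. f x \<noteq> 0}"
    using V(1) unfolding zariski_open_def by (elim exE conjE)
  obtain f a where f: "f \<in> F" "f a \<noteq> 0" using U(2) F(2) by auto
  obtain g b where g: "g \<in> G" "g b \<noteq> 0" using V(2) G(2) by auto
  obtain x where "f x \<noteq> 0" "g x \<noteq> 0"
    using polynomial_maps_common_nonzero[OF inf, of f a g b] F(1) G(1) f g by auto
  then have "x \<in> U" "x \<in> V" using F(2) G(2) f(1) g(1) by auto
  then have "P (hyperplane x) \<and> Q (hyperplane x)" using U(3) V(3) by simp
  then show ?thesis ..
qed

text \<open>A linear map that takes an independent family to the standard basis turns independence of
  nearby families into the nonvanishing of a determinant.\<close>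

lemma indep_family_open:
  fixes q :: "'k::field ^ 'n::finite \<Rightarrow> 'v::finite \<Rightarrow> 'k ^ 'm::finite"
  assumes q: "\<And>v i. polynomial_map (\<lambda>h. q h v $ i)" and ind: "indep_family (q a) A"
  shows "\<exists>f. polynomial_map f \<and> f a \<noteq> 0 \<and> (\<forall>h. f h \<noteq> 0 \<longrightarrow> indep_family (q h) A)"
proof -
  have inj: "inj_on (q a) A" and ind': "vec.independent (q a ` A)"
    using ind by (auto simp: indep_family_iff)
  obtain F :: "'k ^ 'm \<Rightarrow> 'k ^ 'v" where F: "Vector_Spaces.linear (*s) (*s) F"
    "\<forall>b\<in>q a ` A. F b = axis (inv_into A (q a) b) 1"
    using vec.linear_independent_extend[OF ind', of "\<lambda>b. axis (inv_into A (q a) b) 1"] by blast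
  interpret F: Vector_Spaces.linear "(*s)" "(*s)" F by (fact F(1))
  \<comment> \<open>Indices outside \<open>A\<close> are filled with unit rows; the matrix becomes
    square and is the identity at \<open>h = a\<close>.\<close>
  define N :: "'k ^ 'n \<Rightarrow> 'k ^ 'v ^ 'v" where
    "N h = (\<chi> u. if u \<in> A then F (q h u) else axis u 1)" for h
  have Fq: "F y $ j = (\<Sum>i\<in>UNIV. y $ i * F (axis i 1) $ j)" for y j
  proof -
    have "F y = F (\<Sum>i\<in>UNIV. y $ i *s axis i 1)" by (simp add: basis_expansion)
    also have "\<dots> = (\<Sum>i\<in>UNIV. y $ i *s F (axis i 1))" by (simp add: F.sum F.scale)
    finally show ?thesis by simp
  qed
  have pol: "polynomial_map (\<lambda>h. N h $ i $ j)" for i j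
  proof (cases "i \<in> A")
    case True
    have "polynomial_map (\<lambda>h. \<Sum>l\<in>UNIV. q h i $ l * F (axis l 1) $ j)"
      by (rule polynomial_map_sum, rule polynomial_map.mult, rule q, rule polynomial_map.const)
    then show ?thesis using True by (simp add: N_def Fq[of "q _ i"])
  qed (simp add: N_def polynomial_map.const)
  have "N a = mat 1"
    using F(2) inj by (auto simp: N_def vec_eq_iff mat_def axis_def)
  then have "det (N a) \<noteq> 0" by simp
  moreover have "indep_family (q h) A" if "det (N h) \<noteq> 0" for h
    unfolding indep_family_def
  proof (intro allI impI ballI)
    fix c v assume s: "(\<Sum>v\<in>A. c v *s q h v) = 0" and v: "v \<in> A"
    have "invertible (N h)" using that by (simp add: invertible_det_nz)
    then obtain N' where N': "N h ** N' = mat 1" by (auto simp: invertible_def)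
    define x where "x = (\<chi> u. if u \<in> A then c u else 0)"
    have "x v* N h = (\<Sum>u\<in>UNIV. x $ u *s N h $ u)"
      by (simp add: vec_eq_iff vector_matrix_mult_def)
    also have "\<dots> = (\<Sum>u\<in>A. c u *s F (q h u))"
      by (rule sum.mono_neutral_cong_right) (auto simp: x_def N_def)
    also have "\<dots> = F (\<Sum>u\<in>A. c u *s q h u)" by (simp add: F.sum F.scale)
    finally have "x v* N h = 0" using s by simp
    then have "x v* (N h ** N') = 0" by (simp add: vector_matrix_mul_assoc[symmetric])
    then have "x = 0" using N' by simp
    then show "c v = 0" using v by (simp add: x_def vec_eq_iff split: if_splits)
  qed
  ultimately show ?thesis using polynomial_map_det[of N, OF pol]
    by (intro exI[of _ "\<lambda>h. det (N h)"]) auto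
qed

section \<open>Flows on cubic graphs\<close>

text \<open>The orientation and the enumeration of the three edges at each vertex are auxiliary
  choices; they provide signs and make sums over a star explicit.\<close>

locale oriented_cubic_graph =
  fixes ends :: "'e::finite \<Rightarrow> 'v::finite set" and tail head :: "'e \<Rightarrow> 'v"
    and e1 e2 e3 :: "'v \<Rightarrow> 'e"
  assumes graph: "graph ends" and trivalent: "trivalent ends"
    and three_connected: "three_connected ends"
    and orientation: "orientation ends tail head"
    and star: "{e. v \<in> ends e} = {e1 v, e2 v, e3 v}"
    and star_distinct: "e1 v \<noteq> e2 v" "e1 v \<noteq> e3 v" "e2 v \<noteq> e3 v"
begin

lemma ends: "ends e = {tail e, head e}"
  using orientation by (simp add: orientation_def)

lemma tail_neq_head: "tail e \<noteq> head e"
  using graph[unfolded graph_def, rule_format, of e] by (auto simp: ends)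

lemma in_ends_star: "v \<in> ends e \<longleftrightarrow> e = e1 v \<or> e = e2 v \<or> e = e3 v"
  using star[of v] by auto

lemma other_end: "v \<in> ends e \<Longrightarrow> \<exists>a. a \<noteq> v \<and> ends e = {v, a}"
  using ends[of e] tail_neq_head[of e] by (metis insertE insert_commute singletonD)

definition sgn_at :: "'v \<Rightarrow> 'e \<Rightarrow> 'k::field" where
  "sgn_at v e = (if head e = v then 1 else 0) - (if tail e = v then 1 else 0)"

lemma sgn_at_zero: "v \<notin> ends e \<Longrightarrow> sgn_at v e = 0"
  by (auto simp: ends sgn_at_def)

lemma sgn_at_cases: "v \<in> ends e \<Longrightarrow> sgn_at v e = 1 \<or> sgn_at v e = -1"
  using tail_neq_head[of e] by (auto simp: ends sgn_at_def)

lemma sgn_at_nonzero: "v \<in> ends e \<Longrightarrow> sgn_at v e \<noteq> 0"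
  using tail_neq_head[of e] by (auto simp: ends sgn_at_def)

lemma sum_sgn_at: "(\<Sum>v\<in>UNIV. sgn_at v e) = 0"
  by (simp add: sgn_at_def sum_subtractf)

lemma sum_star:
  assumes "\<And>e. v \<notin> ends e \<Longrightarrow> f e = 0"
  shows "(\<Sum>e\<in>UNIV. f e) = f (e1 v) + f (e2 v) + f (e3 v)"
proof -
  have "(\<Sum>e\<in>UNIV. f e) = (\<Sum>e\<in>{e1 v, e2 v, e3 v}. f e)"
    using assms in_ends_star[of v] by (intro sum.mono_neutral_right) auto
  then show ?thesis using star_distinct[of v] by (simp add: add.assoc)
qed

section \<open>Boundaries and unit flows along paths\<close>

definition boundary :: "'k::field ^ 'e \<Rightarrow> 'v \<Rightarrow> 'k" where
  "boundary x v = (\<Sum>e\<in>UNIV. sgn_at v e * x $ e)"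

lemma boundary_star:
  "boundary x v = sgn_at v (e1 v) * x $ e1 v + sgn_at v (e2 v) * x $ e2 v + sgn_at v (e3 v) * x $ e3 v"
  unfolding boundary_def by (rule sum_star) (simp add: sgn_at_zero)

lemma cycle_space_boundary: "cycle_space tail head = {x. \<forall>v. boundary x v = 0}"
  by (simp add: cycle_space_def boundary_def incidence_matrix_def matrix_vector_mult_def vec_eq_iff
      sgn_at_def)

lemma boundary_add: "boundary (x + y) v = boundary x v + boundary y v"
  by (simp add: boundary_def sum.distrib algebra_simps)

lemma boundary_scale: "boundary (c *s x) v = c * boundary x v"
  by (simp add: boundary_def sum_distrib_left algebra_simps)

lemma boundary_axis: "boundary (axis e c) v = sgn_at v e * c"
  by (simp add: boundary_def axis_def if_distrib[of "\<lambda>a. _ * a"] cong: if_cong)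

text \<open>The coefficient \<open>sgn_at b e\<close> makes this the unit flow from \<open>a\<close>
  to \<open>b\<close>, whichever way \<open>e\<close> is oriented.\<close>

lemma boundary_edge:
  assumes "ends e = {a, b}" "a \<noteq> b"
  shows "boundary (axis e (sgn_at b e)) v = (if v = b then 1 else 0) - (if v = a then 1 else 0)"
  using assms ends[of e] tail_neq_head[of e]
  by (auto simp: boundary_axis sgn_at_def doubleton_eq_iff)

text \<open>Each step of the path adds a unit flow along its edge, and the boundaries telescope. All
  vertices of the path avoid \<open>S\<close>, so no edge meeting \<open>S\<close> is used.\<close>

lemma path_flow:
  assumes "(a, b) \<in> {(a, b). a \<notin> S \<and> b \<notin> S \<and> (\<exists>e. ends e = {a, b})}\<^sup>*"
  shows "\<exists>x :: 'k::field ^ 'e.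
    (\<forall>v. boundary x v = (if v = b then 1 else 0) - (if v = a then 1 else 0)) \<and>
    (\<forall>e. ends e \<inter> S \<noteq> {} \<longrightarrow> x $ e = 0)"
  using assms
proof (induction rule: rtrancl_induct)
  case base
  show ?case by (intro exI[of _ 0]) (simp add: boundary_def)
next
  case (step b c)
  then obtain e where e: "ends e = {b, c}" "b \<notin> S" "c \<notin> S" by auto
  obtain x :: "'k ^ 'e" where
    x: "\<forall>v. boundary x v = (if v = b then 1 else 0) - (if v = a then 1 else 0)"
      "\<forall>e. ends e \<inter> S \<noteq> {} \<longrightarrow> x $ e = 0"
    using step.IH by auto
  have bc: "b \<noteq> c" using e(1) graph[unfolded graph_def, rule_format, of e] by auto
  have "boundary (x + axis e (sgn_at c e)) v = (if v = c then 1 else 0) - (if v = a then 1 else 0)"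
    for v using x(1) by (simp add: boundary_add boundary_edge[OF e(1) bc])
  moreover have "(x + axis e (sgn_at c e)) $ e' = 0" if "ends e' \<inter> S \<noteq> {}" for e'
    using that x(2) e by (auto simp: axis_def)
  ultimately show ?case by blast
qed

section \<open>Cycles supplied by 3-connectivity\<close>

lemma connected_avoiding:
  assumes "card S < 3" "a \<notin> S" "b \<notin> S"
  shows "(a, b) \<in> {(a, b). a \<notin> S \<and> b \<notin> S \<and> (\<exists>e. ends e = {a, b})}\<^sup>*"
  using three_connected assms by (auto simp: three_connected_def connected_without_def)

text \<open>With two parallel edges \<open>v\<close> would have at most two neighbours
  \<open>a\<close> and \<open>b\<close>, and deleting them would cut \<open>v\<close> off from some
  further vertex \<open>w\<close>.\<close>

lemma no_parallel_edges:
  assumes "v \<in> ends e" "v \<in> ends e'" "e \<noteq> e'"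
  shows "ends e \<noteq> ends e'"
proof
  assume eq: "ends e = ends e'"
  obtain a where a: "a \<noteq> v" "ends e = {v, a}" using other_end assms(1) by blast
  obtain e'' where e'': "{e. v \<in> ends e} = {e, e', e''}"
  proof -
    have "\<exists>e''. {e1 v, e2 v, e3 v} = {e, e', e''}"
      using assms by (auto simp: in_ends_star)
    then show ?thesis using that star[of v] by auto
  qed
  then obtain b where b: "b \<noteq> v" "ends e'' = {v, b}" using other_end[of v e''] by blast
  have "card {v, a, b} \<le> 3" by (simp add: card_insert_if)
  then have "{v, a, b} \<noteq> UNIV" using three_connected by (auto simp: three_connected_def)
  then obtain w where w: "w \<notin> {v, a, b}" by blast
  have "card {a, b} < 3" by (simp add: card_insert_if)
  then have "(v, w) \<in> {(x, y). x \<notin> {a, b} \<and> y \<notin> {a, b} \<and> (\<exists>e. ends e = {x, y})}\<^sup>*"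
    using a b w by (intro connected_avoiding) auto
  then show False
  proof (cases rule: converse_rtranclE)
    case base then show False using w by simp
  next
    case (step x)
    then obtain f where f: "ends f = {v, x}" "x \<notin> {a, b}" by auto
    then have "f \<in> {e, e', e''}" using e'' by auto
    then show False using f a b eq by (auto simp: doubleton_eq_iff)
  qed
qed

text \<open>The graph stays connected without \<open>u\<close> and \<open>v\<close>; a path from
  \<open>a\<close> to \<open>b\<close> there closes up through \<open>v\<close> to a cycle that
  misses \<open>u\<close>.\<close>

lemma cycle_through:
  assumes u: "u \<noteq> v" and e: "ends e = {v, a}" "a \<noteq> u" and e': "ends e' = {v, b}" "b \<noteq> u"
    and ne: "e \<noteq> e'"
  shows "\<exists>z :: 'k::field ^ 'e. z \<in> cycle_space tail head \<and> z $ e \<noteq> 0 \<and>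
    (\<forall>f. u \<in> ends f \<longrightarrow> z $ f = 0) \<and> (\<forall>f. v \<in> ends f \<longrightarrow> f \<noteq> e \<longrightarrow> f \<noteq> e' \<longrightarrow> z $ f = 0)"
proof -
  have av: "a \<noteq> v" and bv: "b \<noteq> v"
    using e e' graph[unfolded graph_def, rule_format, of e] graph[unfolded graph_def, rule_format, of e']
    by auto
  have "card {u, v} < 3" by (simp add: card_insert_if)
  from path_flow[OF connected_avoiding[OF this, of a b]] e e' av bv
  obtain x :: "'k ^ 'e" where
    x: "\<forall>v. boundary x v = (if v = b then 1 else 0) - (if v = a then 1 else 0)"
      "\<forall>e. ends e \<inter> {u, v} \<noteq> {} \<longrightarrow> x $ e = 0"
    by auto
  have e'': "ends e' = {b, v}" using e' by auto
  \<comment> \<open>The three terms run from \<open>a\<close> to \<open>b\<close>, from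
    \<open>v\<close> to \<open>a\<close> and from \<open>b\<close> back to \<open>v\<close>.\<close>
  define z where "z = x + axis e (sgn_at a e) + axis e' (sgn_at v e')"
  have "boundary z w = 0" for w
    using x(1) av bv
    by (simp add: z_def boundary_add boundary_edge[OF e(1) av[symmetric]] boundary_edge[OF e'' bv])
  moreover have "z $ e \<noteq> 0"
    using x(2) e ne sgn_at_nonzero[of a e] by (simp add: z_def axis_def)
  moreover have "z $ f = 0" if "u \<in> ends f" for f
    using x(2) that e e' u by (auto simp: z_def axis_def)
  moreover have "z $ f = 0" if "v \<in> ends f" "f \<noteq> e" "f \<noteq> e'" for f
    using x(2) that by (auto simp: z_def axis_def)
  ultimately show ?thesis by (intro exI[of _ z]) (auto simp: cycle_space_boundary)
qed

lemma star_neighbours: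
  assumes "v \<in> ends e"
  obtains e' e'' a b c where "ends e = {v, a}" "ends e' = {v, b}" "ends e'' = {v, c}"
    "a \<noteq> b" "a \<noteq> c" "b \<noteq> c" "a \<noteq> v" "b \<noteq> v" "c \<noteq> v" "e \<noteq> e'" "e \<noteq> e''" "e' \<noteq> e''"
proof -
  obtain e' e'' where e': "{e1 v, e2 v, e3 v} = {e, e', e''}" "e \<noteq> e'" "e \<noteq> e''" "e' \<noteq> e''"
  proof -
    consider "e = e1 v" | "e = e2 v" | "e = e3 v" using assms by (auto simp: in_ends_star)
    then show ?thesis
    proof cases
      case 1 then show ?thesis using that[of "e2 v" "e3 v"] star_distinct[of v] by auto
    next
      case 2 then show ?thesis using that[of "e1 v" "e3 v"] star_distinct[of v] by auto
    next
      case 3 then show ?thesis using that[of "e1 v" "e2 v"] star_distinct[of v] by auto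
    qed
  qed
  have v: "v \<in> ends e'" "v \<in> ends e''" using e'(1) star[of v] by auto
  obtain a b c where abc: "ends e = {v, a}" "ends e' = {v, b}" "ends e'' = {v, c}"
    "a \<noteq> v" "b \<noteq> v" "c \<noteq> v"
    using other_end[OF assms] other_end[OF v(1)] other_end[OF v(2)] by auto
  moreover have "a \<noteq> b" "a \<noteq> c" "b \<noteq> c"
    using no_parallel_edges[OF assms v(1) e'(2)] no_parallel_edges[OF assms v(2) e'(3)]
      no_parallel_edges[OF v e'(4)] abc by auto
  ultimately show ?thesis using that e' by blast
qed

text \<open>No edge coordinate vanishes identically on flows, so a generic flow has no zeros. The
  cycle avoids the third neighbour \<open>c\<close> of \<open>tail e\<close>.\<close>

lemma cycle_space_edge_nonzero:
  "\<exists>z :: 'k::field ^ 'e. z \<in> cycle_space tail head \<and> z $ e \<noteq> 0"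
proof -
  have "tail e \<in> ends e" by (simp add: ends)
  then obtain e' e'' a b c where *: "ends e = {tail e, a}" "ends e' = {tail e, b}"
    "ends e'' = {tail e, c}" "a \<noteq> b" "a \<noteq> c" "b \<noteq> c" "a \<noteq> tail e" "b \<noteq> tail e" "c \<noteq> tail e"
    "e \<noteq> e'" "e \<noteq> e''" "e' \<noteq> e''"
    by (rule star_neighbours)
  show ?thesis using cycle_through[OF *(9,1,5,2,6,10)] by blast
qed

text \<open>At most one of the three neighbours of \<open>v\<close> is \<open>u\<close>; a cycle
  through the edges to two others leaves the third edge at \<open>v\<close> without flow. Such a
  flow will separate the points of \<open>u\<close> and \<open>v\<close>.\<close>

lemma cycle_avoiding:
  assumes "u \<noteq> v"
  shows "\<exists>(z :: 'k::field ^ 'e) e f. z \<in> cycle_space tail head \<and> (\<forall>f. u \<in> ends f \<longrightarrow> z $ f = 0) \<and>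
    v \<in> ends e \<and> v \<in> ends f \<and> z $ e \<noteq> 0 \<and> z $ f = 0"
proof -
  have "v \<in> ends (e1 v)" by (simp add: in_ends_star)
  then obtain e' e'' a b c where n: "ends (e1 v) = {v, a}" "ends e' = {v, b}"
    "ends e'' = {v, c}" "a \<noteq> b" "a \<noteq> c" "b \<noteq> c" "a \<noteq> v" "b \<noteq> v" "c \<noteq> v"
    "e1 v \<noteq> e'" "e1 v \<noteq> e''" "e' \<noteq> e''"
    by (rule star_neighbours)
  have *: ?thesis
    if "ends e = {v, a}" "ends e' = {v, b}" "a \<noteq> u" "b \<noteq> u" "e \<noteq> e'" "v \<in> ends f" "f \<noteq> e" "f \<noteq> e'"
    for e e' f a b
  proof -
    from cycle_through[OF assms that(1,3,2,4,5)] obtain z :: "'k ^ 'e" where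
      z: "z \<in> cycle_space tail head \<and> z $ e \<noteq> 0 \<and> (\<forall>f. u \<in> ends f \<longrightarrow> z $ f = 0) \<and>
        (\<forall>f. v \<in> ends f \<longrightarrow> f \<noteq> e \<longrightarrow> f \<noteq> e' \<longrightarrow> z $ f = 0)" ..
    then have "z $ f = 0" using that by simp
    moreover have "v \<in> ends e" using that by simp
    ultimately show ?thesis using z that by (intro exI[of _ z] exI[of _ e] exI[of _ f]) simp
  qed
  have v: "v \<in> ends (e1 v)" "v \<in> ends e'" "v \<in> ends e''" using n by simp_all
  consider "a \<noteq> u" "b \<noteq> u" | "a \<noteq> u" "c \<noteq> u" | "b \<noteq> u" "c \<noteq> u" using n(4-6) by blast
  then show ?thesis
  proof cases
    case 1 then show ?thesis by (rule *[OF n(1,2) _ _ n(10) v(3)]) (use n in simp_all)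
  next
    case 2 then show ?thesis by (rule *[OF n(1,3) _ _ n(11) v(2)]) (use n in simp_all)
  next
    case 3 then show ?thesis by (rule *[OF n(2,3) _ _ n(12) v(1)]) (use n in simp_all)
  qed
qed

section \<open>The dimension of the cycle space\<close>

lemma connected: "(a, b) \<in> {(a, b). \<exists>e. ends e = {a, b}}\<^sup>*"
  using connected_avoiding[of "{}" a b] by simp

lemma card_edges: "2 * CARD('e) = 3 * CARD('v)"
proof -
  have "3 * CARD('v) = (\<Sum>v\<in>UNIV. card {e. v \<in> ends e})"
    using trivalent by (simp add: trivalent_def)
  also have "\<dots> = (\<Sum>v\<in>UNIV. \<Sum>e\<in>UNIV. if v \<in> ends e then 1 else 0)"
    by (simp add: sum.If_cases)
  also have "\<dots> = (\<Sum>e\<in>UNIV. \<Sum>v\<in>UNIV. if v \<in> ends e then 1 else 0)" by (rule sum.swap)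
  also have "\<dots> = (\<Sum>e\<in>(UNIV :: 'e set). 2)"
    using graph by (simp add: sum.If_cases graph_def)
  finally show ?thesis by simp
qed

lemma subspace_cycle_space: "vec.subspace (cycle_space tail head :: ('k::field ^ 'e) set)"
  by (rule vec.subspaceI) (auto simp: cycle_space_boundary boundary_add boundary_scale boundary_def[of 0])

text \<open>Rank-nullity for the boundary map, whose image consists of the vectors with coordinate
  sum zero because the graph is connected.\<close>

lemma dim_cycle_space:
  "vec.dim (cycle_space tail head :: ('k::field ^ 'e) set) + CARD('v) = CARD('e) + 1"
proof -
  define f :: "'k ^ 'e \<Rightarrow> 'k ^ 'v" where "f x = (\<chi> v. boundary x v)" for x
  interpret f: Vector_Spaces.linear "(*s)" "(*s)" f
    by unfold_locales (auto simp: f_def vec_eq_iff boundary_add boundary_scale)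
  have ker: "{x. f x = 0} = cycle_space tail head"
    by (auto simp: f_def vec_eq_iff cycle_space_boundary)
  have sub: "vec.subspace (range f)" using f.subspace_image[OF vec.subspace_UNIV] .
  have "range f = hyperplane 1"
  proof (intro equalityI subsetI)
    fix y assume "y \<in> range f"
    then obtain x where "y = f x" by auto
    then have "(\<Sum>v\<in>UNIV. y $ v) = (\<Sum>v\<in>UNIV. \<Sum>e\<in>UNIV. sgn_at v e * x $ e)"
      by (simp add: f_def boundary_def)
    also have "\<dots> = (\<Sum>e\<in>UNIV. \<Sum>v\<in>UNIV. sgn_at v e * x $ e)" by (rule sum.swap)
    also have "\<dots> = 0" by (simp add: sum_distrib_right[symmetric] sum_sgn_at)
    finally show "y \<in> hyperplane 1" by (simp add: hyperplane_def)
  next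
    fix y :: "'k ^ 'v" assume "y \<in> hyperplane 1"
    then have y: "(\<Sum>v\<in>UNIV. y $ v) = 0" by (simp add: hyperplane_def)
    obtain a :: 'v where True by simp
    \<comment> \<open>Differences of unit vectors are boundaries of unit flows along paths, and they
      span the sum-zero hyperplane.\<close>
    have *: "axis v 1 - axis a 1 \<in> range f" for v
    proof -
      have "(a, v) \<in> {(a, b). a \<notin> {} \<and> b \<notin> {} \<and> (\<exists>e. ends e = {a, b})}\<^sup>*"
        using connected by simp
      from path_flow[OF this] obtain x :: "'k ^ 'e" where
        "\<forall>w. boundary x w = (if w = v then 1 else 0) - (if w = a then 1 else 0)" by auto
      then have "axis v 1 - axis a 1 = f x" by (simp add: f_def vec_eq_iff axis_def)
      then show ?thesis by simp
    qed
    have "(\<Sum>v\<in>UNIV. y $ v *s (axis v 1 - axis a 1))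
        = (\<Sum>v\<in>UNIV. y $ v *s axis v 1) - (\<Sum>v\<in>UNIV. y $ v) *s axis a 1"
      by (simp add: vec.scale_right_diff_distrib sum_subtractf vec.scale_sum_left)
    also have "\<dots> = y" using y by (simp add: basis_expansion)
    finally have "(\<Sum>v\<in>UNIV. y $ v *s (axis v 1 - axis a 1)) = y" .
    moreover have "(\<Sum>v\<in>UNIV. y $ v *s (axis v 1 - axis a 1)) \<in> range f"
      by (rule vec.subspace_sum[OF sub], rule vec.subspace_scale[OF sub], rule *)
    ultimately show "y \<in> range f" by simp
  qed
  then have "vec.dim (range f) = CARD('v) - 1"
    using dim_hyperplane[of "1 :: 'k ^ 'v"] by (simp add: vec_eq_iff)
  moreover have "CARD('v) > 0" by simp
  ultimately show ?thesis using rank_nullity_vec[OF f.linear_axioms] unfolding ker by linarith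
qed

lemma dim_cycle_space_eq:
  assumes "CARD('v) = 2 * CARD('g::finite) - 2"
  shows "vec.dim (cycle_space tail head :: ('k::field ^ 'e) set) = CARD('g)"
proof -
  \<comment> \<open>A positive number of vertices keeps the truncated subtraction in
    \<open>2 * CARD('g) - 2\<close> honest.\<close>
  have "CARD('v) > 3" using three_connected by (simp add: three_connected_def)
  then show ?thesis using card_edges assms dim_cycle_space[where ?'k = 'k] by linarith
qed

section \<open>The alternating form of a pair of flows\<close>

text \<open>The signed values of a flow at \<open>v\<close> sum to zero, so for two flows another
  pair of edges at \<open>v\<close> would give the same determinant up to sign.\<close>

definition wedge :: "'v \<Rightarrow> 'k::field ^ 'e \<Rightarrow> 'k ^ 'e \<Rightarrow> 'k" where
  "wedge v y z = sgn_at v (e1 v) * sgn_at v (e2 v) * (y $ e2 v * z $ e1 v - y $ e1 v * z $ e2 v)"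

text \<open>The determinant makes the values on two edges proportional, and conservation at
  \<open>v\<close> extends this to the third.\<close>

lemma wedge_eq_0_imp_proportional:
  fixes y z :: "'k::field ^ 'e"
  assumes "y \<in> cycle_space tail head" "z \<in> cycle_space tail head" "\<And>e. y $ e \<noteq> 0" "wedge v y z = 0"
  shows "\<exists>t. \<forall>e. v \<in> ends e \<longrightarrow> z $ e = t * y $ e"
proof -
  let ?s1 = "sgn_at v (e1 v) :: 'k" and ?s2 = "sgn_at v (e2 v) :: 'k" and ?s3 = "sgn_at v (e3 v) :: 'k"
  have s: "?s1 \<noteq> 0" "?s2 \<noteq> 0" "?s3 \<noteq> 0" by (simp_all add: sgn_at_nonzero in_ends_star)
  define t where "t = z $ e1 v / y $ e1 v"
  have z1: "z $ e1 v = t * y $ e1 v" using assms(3) by (simp add: t_def)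
  have "y $ e2 v * z $ e1 v = y $ e1 v * z $ e2 v" using assms(4) s by (simp add: wedge_def)
  then have z2: "z $ e2 v = t * y $ e2 v" using assms(3)[of "e1 v"] by (simp add: t_def field_simps)
  have "?s1 * y $ e1 v + ?s2 * y $ e2 v + ?s3 * y $ e3 v = 0"
    "?s1 * z $ e1 v + ?s2 * z $ e2 v + ?s3 * z $ e3 v = 0"
    using assms(1,2) by (auto simp: cycle_space_boundary boundary_star)
  then have "?s3 * z $ e3 v = ?s3 * (t * y $ e3 v)" unfolding z1 z2 by algebra
  then have "z $ e3 v = t * y $ e3 v" using s by simp
  then show ?thesis using z1 z2 by (auto simp: in_ends_star)
qed

text \<open>The local ratios agree at both ends of an edge, as \<open>y\<close> is nonzero there;
  connectivity makes them globally constant.\<close>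

lemma wedge_all_0_imp_multiple:
  fixes y z :: "'k::field ^ 'e"
  assumes y: "y \<in> cycle_space tail head" and z: "z \<in> cycle_space tail head"
    and nz: "\<And>e. y $ e \<noteq> 0" and w: "\<And>v. wedge v y z = 0"
  shows "\<exists>c. z = c *s y"
proof -
  obtain t where t: "\<And>v e. v \<in> ends e \<Longrightarrow> z $ e = t v * y $ e"
    using wedge_eq_0_imp_proportional[OF y z nz w] by metis
  have "t a = t b" for a b
    using connected[of a b]
  proof (induction rule: rtrancl_induct)
    case (step b c)
    then obtain e where "ends e = {b, c}" by auto
    then show ?case using t[of b e] t[of c e] nz[of e] step.IH by simp
  qed simp
  then have "z $ e = t undefined * y $ e" for e
    using t[of "tail e" e] by (metis ends insertI1)
  then show ?thesis by (intro exI[of _ "t undefined"]) (simp add: vec_eq_iff)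
qed

definition star_weight :: "'k::field ^ 'e \<Rightarrow> 'v \<Rightarrow> 'k" where
  "star_weight y v = (sgn_at v (e1 v) * y $ e1 v) * (sgn_at v (e2 v) * y $ e2 v) * (sgn_at v (e3 v) * y $ e3 v)"

lemma star_weight_nonzero: "(\<And>e. y $ e \<noteq> 0) \<Longrightarrow> star_weight y v \<noteq> 0"
  by (simp add: star_weight_def sgn_at_nonzero in_ends_star)

text \<open>Clearing denominators leaves a polynomial identity modulo the three linear
  relations.\<close>

lemma three_term_identity:
  fixes Y1 :: "'k::field"
  assumes "Y1 + Y2 + Y3 = 0" "Z1 + Z2 + Z3 = 0" "W1 + W2 + W3 = 0" "Y1 \<noteq> 0" "Y2 \<noteq> 0" "Y3 \<noteq> 0"
  shows "Z1 * W1 / Y1 + Z2 * W2 / Y2 + Z3 * W3 / Y3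
    = - ((Y2 * Z1 - Y1 * Z2) * (Y2 * W1 - Y1 * W2)) / (Y1 * Y2 * Y3)"
proof -
  have "Z1 * W1 * Y2 * Y3 + Z2 * W2 * Y1 * Y3 + Z3 * W3 * Y1 * Y2
    = - ((Y2 * Z1 - Y1 * Z2) * (Y2 * W1 - Y1 * W2))"
    using assms(1-3) by algebra
  then show ?thesis using assms(4-6) by (simp add: divide_simps) (simp add: algebra_simps)
qed

text \<open>Locally at \<open>v\<close> the product of the two forms is the residue-like sum of \<open>z w / y\<close> over the
  edges at \<open>v\<close>; in the total sum every edge occurs twice, with opposite signs.\<close>

lemma sum_wedge_wedge:
  fixes y z w :: "'k::field ^ 'e"
  assumes y: "y \<in> cycle_space tail head" and z: "z \<in> cycle_space tail head"
    and w: "w \<in> cycle_space tail head" and nz: "\<And>e. y $ e \<noteq> 0"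
  shows "(\<Sum>v\<in>UNIV. wedge v y z * wedge v y w / star_weight y v) = 0"
proof -
  have "(\<Sum>e\<in>UNIV. sgn_at v e * (z $ e * w $ e / y $ e))
      = - (wedge v y z * wedge v y w / star_weight y v)" for v
  proof -
    let ?s1 = "sgn_at v (e1 v) :: 'k" and ?s2 = "sgn_at v (e2 v) :: 'k" and ?s3 = "sgn_at v (e3 v) :: 'k"
    have e: "v \<in> ends (e1 v)" "v \<in> ends (e2 v)" "v \<in> ends (e3 v)" by (simp_all add: in_ends_star)
    \<comment> \<open>A sign \<open>s\<close> satisfies \<open>s = s * s / s\<close>, so signs can
      be moved onto all three flows.\<close>
    have q: "sgn_at v e * (z $ e * w $ e / y $ e)
        = (sgn_at v e * z $ e) * (sgn_at v e * w $ e) / (sgn_at v e * y $ e)" if "v \<in> ends e" for e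
      using sgn_at_cases[OF that, where ?'a = 'k] by auto
    have "(\<Sum>e\<in>UNIV. sgn_at v e * (z $ e * w $ e / y $ e))
        = ?s1 * (z $ e1 v * w $ e1 v / y $ e1 v) + ?s2 * (z $ e2 v * w $ e2 v / y $ e2 v)
          + ?s3 * (z $ e3 v * w $ e3 v / y $ e3 v)"
      by (rule sum_star) (simp add: sgn_at_zero)
    also have "\<dots> = - (((?s2 * y $ e2 v) * (?s1 * z $ e1 v) - (?s1 * y $ e1 v) * (?s2 * z $ e2 v))
        * ((?s2 * y $ e2 v) * (?s1 * w $ e1 v) - (?s1 * y $ e1 v) * (?s2 * w $ e2 v)))
        / ((?s1 * y $ e1 v) * (?s2 * y $ e2 v) * (?s3 * y $ e3 v))"
      unfolding q[OF e(1)] q[OF e(2)] q[OF e(3)]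
      by (rule three_term_identity)
        (use y z w in \<open>simp_all add: cycle_space_boundary boundary_star nz sgn_at_nonzero e\<close>)
    also have "\<dots> = - (wedge v y z * wedge v y w / star_weight y v)"
    proof -
      have "(?s2 * y $ e2 v) * (?s1 * x $ e1 v) - (?s1 * y $ e1 v) * (?s2 * x $ e2 v) = wedge v y x" for x
        by (simp add: wedge_def algebra_simps)
      then show ?thesis by (simp add: star_weight_def)
    qed
    finally show ?thesis .
  qed
  then have "(\<Sum>v\<in>UNIV. wedge v y z * wedge v y w / star_weight y v)
      = - (\<Sum>v\<in>UNIV. \<Sum>e\<in>UNIV. sgn_at v e * (z $ e * w $ e / y $ e))"
    by (simp add: sum_negf)
  also have "\<dots> = - (\<Sum>e\<in>UNIV. \<Sum>v\<in>UNIV. sgn_at v e * (z $ e * w $ e / y $ e))"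
    by (subst sum.swap) simp
  also have "\<dots> = 0" unfolding sum_distrib_right[symmetric] sum_sgn_at by simp
  finally show ?thesis .
qed

end

section \<open>Hyperplane sections of graph curves\<close>

lemma dotp_column: "dotp w (column e C) = (w v* C) $ e"
  by (simp add: dotp_def column_def vector_matrix_mult_def)

lemma vector_matrix_mult_rows: "w v* C = (\<Sum>i\<in>UNIV. w $ i *s row i C)"
  by (simp add: vec_eq_iff vector_matrix_mult_def row_def)

lemma linear_vector_matrix_mult: "Vector_Spaces.linear (*s) (*s) (\<lambda>w. w v* C)"
  for C :: "'k::field ^ 'e::finite ^ 'g::finite"
  by unfold_locales (simp_all add: vec_eq_iff vector_matrix_mult_def sum.distrib algebra_simps
      sum_distrib_left)

text \<open>For a cycle matrix this turns functionals \<open>w\<close> on the ambient space into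
  flows \<open>w v* C\<close>.\<close>

lemma span_rows: "vec.span (rows C) = range (\<lambda>w. w v* C)"
  for C :: "'k::field ^ 'e::finite ^ 'g::finite"
proof (intro equalityI subsetI)
  fix y assume "y \<in> range (\<lambda>w. w v* C)"
  then obtain w where "y = (\<Sum>i\<in>UNIV. w $ i *s row i C)" by (auto simp: vector_matrix_mult_rows)
  moreover have "row i C \<in> vec.span (rows C)" for i by (rule vec.span_base) (auto simp: rows_def)
  ultimately show "y \<in> vec.span (rows C)" by (simp add: vec.span_sum vec.span_scale)
next
  have "rows C \<subseteq> range (\<lambda>w. w v* C)"
  proof
    fix y assume "y \<in> rows C"
    then obtain i where "y = row i C" by (auto simp: rows_def)
    then have "y = axis i 1 v* C"
      by (simp add: vec_eq_iff vector_matrix_mult_def axis_def row_def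
          if_distrib[of "\<lambda>a. a * _"] cong: if_cong)
    then show "y \<in> range (\<lambda>w. w v* C)" by blast
  qed
  moreover have "vec.subspace (range (\<lambda>w. w v* C))"
  proof -
    interpret Vector_Spaces.linear "(*s)" "(*s)" "\<lambda>w. w v* C" by (rule linear_vector_matrix_mult)
    show ?thesis by (rule subspace_image[OF vec.subspace_UNIV])
  qed
  ultimately have "vec.span (rows C) \<subseteq> range (\<lambda>w. w v* C)" by (rule vec.span_minimal)
  then show "y \<in> range (\<lambda>w. w v* C)" if "y \<in> vec.span (rows C)" for y using that by blast
qed

text \<open>The graph-free core of self-duality: \<open>qh\<close> and \<open>ann\<close> say that
  the vectors span the hyperplane, and \<open>iso\<close> is the vanishing of a diagonal form with
  nonzero weights.\<close>

lemma self_dual_indep_family: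
  fixes q :: "'v::finite \<Rightarrow> 'k::field ^ 'g::finite" and h :: "'k ^ 'g"
  assumes h: "h \<noteq> 0" and qh: "\<And>v. dotp h (q v) = 0"
    and ann: "\<And>w. (\<forall>v. dotp w (q v) = 0) \<Longrightarrow> \<exists>c. w = c *s h"
    and iso: "\<And>w. (\<Sum>v\<in>UNIV. (l v * dotp w (q v)) *s q v) = 0" and l: "\<And>v. l v \<noteq> 0"
    and card: "CARD('v) = 2 * (CARD('g) - 1)"
  shows "self_dual_matroid (CARD('g) - 1) UNIV {A. indep_family q A}"
proof -
  let ?n = "CARD('g) - 1"
  have qH: "q ` A \<subseteq> hyperplane h" for A using qh by (auto simp: hyperplane_dotp)
  have dimH: "vec.dim (hyperplane h) = ?n" by (rule dim_hyperplane[OF h])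
  have spanning: "hyperplane h \<subseteq> vec.span (q ` A)"
    if A: "\<And>w. (\<forall>v\<in>A. dotp w (q v) = 0) \<Longrightarrow> (\<forall>v. dotp w (q v) = 0)" for A
  proof (rule subsetI, rule ccontr)
    \<comment> \<open>A functional separating \<open>x\<close> from the span would be a multiple of
      \<open>h\<close>, but \<open>h\<close> vanishes at \<open>x\<close>.\<close>
    fix x assume x: "x \<in> hyperplane h" "x \<notin> vec.span (q ` A)"
    obtain w where w: "dotp w x = 1" "\<forall>s\<in>q ` A. dotp w s = 0"
      using dotp_separates_span[OF x(2)] by auto
    then obtain c where "w = c *s h" using ann[of w] A[of w] by auto
    then show False using w(1) x(1) by (simp add: dotp_scale_left hyperplane_dotp)
  qed
  have dim_le: "vec.dim (q ` A) \<le> ?n" for A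
    using vec.dim_subset[OF qH] dimH by metis
  have card_le: "card A \<le> ?n" if "indep_family q A" for A
    using dim_le[of A] that by (simp add: indep_family_iff_dim)
  have full: "vec.dim (q ` A) = ?n"
    if "\<And>w. (\<forall>v\<in>A. dotp w (q v) = 0) \<Longrightarrow> (\<forall>v. dotp w (q v) = 0)" for A
    using vec.dim_mono[OF spanning[of A, OF that]] dim_le[of A] dimH by simp
  have card_compl: "card (- A) = ?n" if "card A = ?n" for A :: "'v set"
  proof -
    have "card (UNIV - A) = CARD('v) - card A" by (simp add: card_Diff_subset)
    then show ?thesis using that card unfolding Compl_eq_Diff_UNIV by linarith
  qed
  have compl: "indep_family q (- A)" if A: "indep_family q A" "card A = ?n" for A
  proof -
    have "\<forall>v. dotp w (q v) = 0" if w: "\<forall>v\<in>- A. dotp w (q v) = 0" for w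
    proof -
      \<comment> \<open>Terms outside \<open>A\<close> vanish, so \<open>iso\<close> becomes a
        relation on the independent family \<open>A\<close> and all its coefficients are
        zero.\<close>
      have "(\<Sum>v\<in>UNIV. (l v * dotp w (q v)) *s q v) = (\<Sum>v\<in>A. (l v * dotp w (q v)) *s q v)"
        using w by (intro sum.mono_neutral_right) auto
      then have "\<forall>v\<in>A. l v * dotp w (q v) = 0"
        using A(1)[unfolded indep_family_def, rule_format, of "\<lambda>v. l v * dotp w (q v)"] iso[of w] by auto
      then show ?thesis using w l by (metis ComplI mult_eq_0_iff)
    qed
    then have "vec.dim (q ` (- A)) = ?n" by (rule full)
    moreover have "card (- A) = ?n" using A(2) by (rule card_compl)
    ultimately show ?thesis by (simp add: indep_family_iff_dim)
  qed
  \<comment> \<open>A basis chosen among all the vectors shows that the rank is attained.\<close>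
  obtain B where B: "B \<subseteq> q ` UNIV" "vec.independent B" "q ` UNIV \<subseteq> vec.span B"
    "card B = vec.dim (q ` UNIV)" by (rule vec.basis_exists)
  obtain A where A: "inj_on q A" "q ` A = B"
    using subset_image_inj[of B q UNIV] B(1) by auto
  have "indep_family q A" using A B(2) by (simp add: indep_family_iff)
  moreover have "card A = ?n"
    using A B(4) full[of UNIV] card_image[OF A(1)] by simp
  ultimately have "?n \<in> card ` {A. indep_family q A}" by (intro image_eqI[of _ _ A]) auto
  then have rank: "matroid_rank {A. indep_family q A} = ?n"
    unfolding matroid_rank_def using card_le by (intro Max_eqI) auto
  have basis: "matroid_basis {A. indep_family q A} A \<longleftrightarrow> indep_family q A" if "card A = ?n" for A
  proof -
    have "A' = A" if "indep_family q A'" "A \<subseteq> A'" for A'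
      using card_le[OF that(1)] \<open>card A = ?n\<close> that(2) by (metis card_seteq finite)
    then show ?thesis by (auto simp: matroid_basis_def)
  qed
  show ?thesis
    unfolding self_dual_matroid_def
  proof (intro conjI allI impI matroid_indep_family rank card)
    fix A :: "'v set" assume A: "card A = ?n"
    have cA: "card (- A) = ?n" using A by (rule card_compl)
    have "indep_family q A \<longleftrightarrow> indep_family q (- A)"
      using compl[of A] compl[of "- A"] A cA by auto
    then show "matroid_basis {A. indep_family q A} A \<longleftrightarrow> matroid_basis {A. indep_family q A} (UNIV - A)"
      using basis[OF A] basis[OF cA] by (simp add: Compl_eq_Diff_UNIV)
  qed
qed

context oriented_cubic_graph
begin

text \<open>The functional \<open>h\<close> has the value \<open>(h v* Cyc) $ e\<close> on column \<open>e\<close>, so this combination of two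
  columns at \<open>v\<close> spans the point where the line of \<open>v\<close> meets \<open>hyperplane h\<close>.\<close>

definition section_vec :: "'k::field ^ 'e ^ 'g::finite \<Rightarrow> 'k ^ 'g \<Rightarrow> 'v \<Rightarrow> 'k ^ 'g" where
  "section_vec Cyc h v = (sgn_at v (e1 v) * sgn_at v (e2 v)) *s
     ((h v* Cyc) $ e2 v *s column (e1 v) Cyc - (h v* Cyc) $ e1 v *s column (e2 v) Cyc)"

lemma dotp_section_vec: "dotp w (section_vec Cyc h v) = wedge v (h v* Cyc) (w v* Cyc)"
  by (simp add: section_vec_def wedge_def dotp_simps dotp_column)

lemma polynomial_section_vec:
  fixes Cyc :: "'k::field ^ 'e ^ 'g::finite"
  shows "polynomial_map (\<lambda>h. section_vec Cyc h v $ i)"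
proof -
  have y: "polynomial_map (\<lambda>h. (h v* Cyc) $ e * c)" for e c
    unfolding vector_matrix_mult_def vec_lambda_beta
    by (rule polynomial_map.mult, rule polynomial_map_sum, rule polynomial_map.mult,
        rule polynomial_map.coord, rule polynomial_map.const, rule polynomial_map.const)
  let ?s = "sgn_at v (e1 v) * sgn_at v (e2 v) :: 'k"
  have "polynomial_map (\<lambda>h. (h v* Cyc) $ e2 v * (?s * Cyc $ i $ e1 v)
      + (h v* Cyc) $ e1 v * (- ?s * Cyc $ i $ e2 v))"
    by (rule polynomial_map.add; rule y)
  then show ?thesis by (simp add: section_vec_def column_def algebra_simps)
qed

section \<open>Flows as functionals for a fixed cycle matrix\<close>

context
  fixes Cyc :: "'k::field ^ 'e ^ 'g::finite"
  assumes rows: "vec.span (rows Cyc) = cycle_space tail head"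
    and card_g: "CARD('v) = 2 * CARD('g) - 2"
begin

lemma flow_in_cycle_space: "w v* Cyc \<in> cycle_space tail head"
  using rows span_rows[of Cyc] by auto

lemma cycle_space_flow: "z \<in> cycle_space tail head \<Longrightarrow> \<exists>w. z = w v* Cyc"
  using rows span_rows[of Cyc] by auto

text \<open>The range is the cycle space, of full dimension \<open>CARD('g)\<close>, so the kernel
  is zero.\<close>

lemma flow_inj: "w v* Cyc = 0 \<Longrightarrow> w = 0"
proof -
  have "vec.dim {w. w v* Cyc = 0} = 0"
    using rank_nullity_vec[OF linear_vector_matrix_mult[of Cyc]] dim_cycle_space_eq[OF card_g, where ?'k = 'k]
      rows span_rows[of Cyc] by simp
  then show "w v* Cyc = 0 \<Longrightarrow> w = 0" by (auto simp: vec.dim_eq_0)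
qed

text \<open>Every row is a flow; its conservation law at \<open>v\<close>, read across all rows, is
  a relation between columns.\<close>

lemma column_relation:
  "sgn_at v (e1 v) *s column (e1 v) Cyc + sgn_at v (e2 v) *s column (e2 v) Cyc
     + sgn_at v (e3 v) *s column (e3 v) Cyc = 0"
proof -
  have "row i Cyc \<in> cycle_space tail head" for i
    unfolding rows[symmetric] by (rule vec.span_base) (auto simp: rows_def)
  then have "boundary (row i Cyc) v = 0" for i by (simp add: cycle_space_boundary)
  then show ?thesis by (simp add: vec_eq_iff column_def row_def boundary_star)
qed

lemma graph_curve_line_span:
  "graph_curve_line ends Cyc v = vec.span {column (e1 v) Cyc, column (e2 v) Cyc}"
proof -
  have set: "{column e Cyc |e. v \<in> ends e} = {column (e1 v) Cyc, column (e2 v) Cyc, column (e3 v) Cyc}"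
    by (auto simp: in_ends_star)
  let ?S = "vec.span {column (e1 v) Cyc, column (e2 v) Cyc}"
  let ?s1 = "sgn_at v (e1 v) :: 'k" and ?s2 = "sgn_at v (e2 v) :: 'k" and ?s3 = "sgn_at v (e3 v) :: 'k"
  have s3: "?s3 \<noteq> 0" by (simp add: sgn_at_nonzero in_ends_star)
  have "?s3 *s column (e3 v) Cyc = - (?s1 *s column (e1 v) Cyc) - ?s2 *s column (e2 v) Cyc"
    using column_relation[of v] by (simp add: eq_neg_iff_add_eq_0 algebra_simps)
  also have "\<dots> \<in> ?S" by (intro vec.span_diff vec.span_neg vec.span_scale vec.span_base) auto
  finally have "(1 / ?s3) *s (?s3 *s column (e3 v) Cyc) \<in> ?S" by (rule vec.span_scale)
  then have "column (e3 v) Cyc \<in> ?S" using s3 by simp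
  then show ?thesis unfolding graph_curve_line_def set vec.span_eq by (auto intro: vec.span_base)
qed

section \<open>Sections by a hyperplane whose flow has no zeros\<close>

context
  fixes h :: "'k ^ 'g"
  assumes nz: "\<And>e. (h v* Cyc) $ e \<noteq> 0"
begin

lemma section_point_span: "section_point ends Cyc (hyperplane h) v = vec.span {section_vec Cyc h v}"
proof (intro equalityI subsetI)
  let ?y = "h v* Cyc"
  let ?s = "sgn_at v (e1 v) * sgn_at v (e2 v) :: 'k"
  have s: "?s \<noteq> 0" by (simp add: sgn_at_nonzero in_ends_star)
  fix x assume "x \<in> section_point ends Cyc (hyperplane h) v"
  then have x: "x \<in> vec.span {column (e1 v) Cyc, column (e2 v) Cyc}" "dotp h x = 0"
    by (auto simp: section_point_def graph_curve_line_span hyperplane_dotp)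
  obtain a b where ab: "x = a *s column (e1 v) Cyc + b *s column (e2 v) Cyc"
    using x(1) by (auto simp: vec.span_insert algebra_simps)
  have "a * ?y $ e1 v + b * ?y $ e2 v = 0" using x(2) by (simp add: ab dotp_simps dotp_column)
  \<comment> \<open>Vanishing under \<open>h\<close> fixes the ratio of the two coefficients, which
    leaves a single point.\<close>
  then have b: "b = - (a / ?y $ e2 v) * ?y $ e1 v"
    using nz by (simp add: field_simps eq_neg_iff_add_eq_0)
  have "x = (a / ?y $ e2 v) *s (?y $ e2 v *s column (e1 v) Cyc - ?y $ e1 v *s column (e2 v) Cyc)"
    unfolding ab b using nz[of "e2 v"] by (simp add: vec_eq_iff right_diff_distrib)
  also have "\<dots> = (a / ?y $ e2 v / ?s) *s section_vec Cyc h v"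
    using s by (simp add: section_vec_def)
  finally show "x \<in> vec.span {section_vec Cyc h v}"
    by (simp only: vec.span_scale vec.span_base insertI1)
next
  fix x assume "x \<in> vec.span {section_vec Cyc h v}"
  then obtain c where c: "x = c *s section_vec Cyc h v" by (auto simp: vec.span_singleton)
  have "section_vec Cyc h v \<in> vec.span {column (e1 v) Cyc, column (e2 v) Cyc}"
    unfolding section_vec_def by (intro vec.span_scale vec.span_diff vec.span_base) auto
  then have "x \<in> graph_curve_line ends Cyc v"
    unfolding c graph_curve_line_span by (rule vec.span_scale)
  moreover have "dotp h x = 0" by (simp add: c dotp_simps dotp_section_vec wedge_def)
  ultimately show "x \<in> section_point ends Cyc (hyperplane h) v"
    by (simp add: section_point_def hyperplane_dotp)
qed

text \<open>A flow that vanishes around \<open>u\<close> and on some but not all edges at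
  \<open>v\<close> is not proportional to the nowhere zero flow of \<open>h\<close> at
  \<open>v\<close>.\<close>

lemma section_points_separated:
  assumes "u \<noteq> v"
  shows "\<exists>w. dotp w (section_vec Cyc h u) = 0 \<and> dotp w (section_vec Cyc h v) \<noteq> 0"
proof -
  obtain z :: "'k ^ 'e" and e f where z: "z \<in> cycle_space tail head" "\<forall>f. u \<in> ends f \<longrightarrow> z $ f = 0"
    "v \<in> ends e" "v \<in> ends f" "z $ e \<noteq> 0" "z $ f = 0"
    using cycle_avoiding[OF assms] by blast
  obtain w where w: "z = w v* Cyc" using cycle_space_flow[OF z(1)] by blast
  have "wedge u (h v* Cyc) z = 0" using z(2) by (simp add: wedge_def in_ends_star)
  moreover have "wedge v (h v* Cyc) z \<noteq> 0"
  proof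
    assume "wedge v (h v* Cyc) z = 0"
    then obtain t where "\<forall>e. v \<in> ends e \<longrightarrow> z $ e = t * (h v* Cyc) $ e"
      using wedge_eq_0_imp_proportional[OF flow_in_cycle_space z(1) nz] by blast
    then show False using z nz[of f] by auto
  qed
  ultimately show ?thesis using w by (auto simp: dotp_section_vec)
qed

lemma distinct_section_points: "distinct_points (section_point ends Cyc (hyperplane h))"
  unfolding distinct_points_def section_point_span
proof (intro conjI allI)
  fix v
  show "vec.subspace (vec.span {section_vec Cyc h v})" by simp
  have "card (UNIV - {v}) > 0"
    using three_connected by (simp add: three_connected_def card_Diff_singleton)
  then obtain u where "u \<noteq> v" by (metis Diff_iff card_gt_0_iff ex_in_conv singletonI)
  from section_points_separated[OF this] have "section_vec Cyc h v \<noteq> 0" by (auto simp: dotp_simps)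
  then show "vec.dim (vec.span {section_vec Cyc h v}) = 1" by simp
next
  show "inj (\<lambda>v. vec.span {section_vec Cyc h v})"
  proof (rule injI, rule ccontr)
    fix u v assume eq: "vec.span {section_vec Cyc h u} = vec.span {section_vec Cyc h v}" and "u \<noteq> v"
    then obtain w where w: "dotp w (section_vec Cyc h u) = 0" "dotp w (section_vec Cyc h v) \<noteq> 0"
      using section_points_separated by blast
    have "section_vec Cyc h v \<in> vec.span {section_vec Cyc h u}"
      unfolding eq by (rule vec.span_base) simp
    then show False using w by (auto simp: vec.span_singleton dotp_simps)
  qed
qed

lemma point_matroid_section:
  "point_matroid (section_point ends Cyc (hyperplane h)) = {A. indep_family (section_vec Cyc h) A}"
  unfolding section_point_span by (rule point_matroid_span)

text \<open>The annihilator condition comes from \<open>wedge_all_0_imp_multiple\<close> and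
  \<open>flow_inj\<close>, the relation between the points from
  \<open>sum_wedge_wedge\<close>.\<close>

lemma self_dual_section:
  "self_dual_matroid (CARD('g) - 1) UNIV {A. indep_family (section_vec Cyc h) A}"
proof (rule self_dual_indep_family[where h = h and l = "\<lambda>v. 1 / star_weight (h v* Cyc) v"])
  show "h \<noteq> 0" using nz by auto
  show "dotp h (section_vec Cyc h v) = 0" for v by (simp add: dotp_section_vec wedge_def)
  show "1 / star_weight (h v* Cyc) v \<noteq> 0" for v using star_weight_nonzero[OF nz] by simp
  show "CARD('v) = 2 * (CARD('g) - 1)" using card_g by simp
next
  fix w assume "\<forall>v. dotp w (section_vec Cyc h v) = 0"
  then have "\<And>v. wedge v (h v* Cyc) (w v* Cyc) = 0" by (simp add: dotp_section_vec)
  from wedge_all_0_imp_multiple[OF flow_in_cycle_space flow_in_cycle_space nz this]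
  obtain c where "w v* Cyc = c *s (h v* Cyc)" by blast
  then have "(w - c *s h) v* Cyc = 0"
    by (simp add: vector_matrix_mult_diff_distrib scalar_vector_matrix_assoc)
  then have "w - c *s h = 0" by (rule flow_inj)
  then show "\<exists>c. w = c *s h" by auto
next
  fix w
  let ?x = "\<Sum>v\<in>UNIV. (1 / star_weight (h v* Cyc) v * dotp w (section_vec Cyc h v)) *s section_vec Cyc h v"
  have "dotp u ?x = 0" for u
    using sum_wedge_wedge[OF flow_in_cycle_space flow_in_cycle_space flow_in_cycle_space nz, of w u]
    by (simp add: dotp_sum dotp_simps dotp_section_vec)
  then show "?x = 0" unfolding dotp_eq_0_iff by blast
qed

end

text \<open>The right-hand side depends on \<open>Cyc\<close> only through the flow \<open>h v* Cyc\<close>, which is why the generic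
  matroid does not depend on the realization.\<close>

lemma indep_family_section_vec:
  "indep_family (section_vec Cyc h) A \<longleftrightarrow>
    (\<forall>c. (\<forall>z\<in>cycle_space tail head. (\<Sum>v\<in>A. c v * wedge v (h v* Cyc) z) = 0) \<longrightarrow> (\<forall>v\<in>A. c v = 0))"
proof -
  have "(\<Sum>v\<in>A. c v *s section_vec Cyc h v) = 0 \<longleftrightarrow>
      (\<forall>z\<in>cycle_space tail head. (\<Sum>v\<in>A. c v * wedge v (h v* Cyc) z) = 0)" (is "?x = 0 \<longleftrightarrow> ?R") for c
  proof -
    have "?x = 0 \<longleftrightarrow> (\<forall>w. dotp w ?x = 0)" by (rule dotp_eq_0_iff)
    also have "\<dots> \<longleftrightarrow> (\<forall>w. (\<Sum>v\<in>A. c v * wedge v (h v* Cyc) (w v* Cyc)) = 0)"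
      by (simp add: dotp_sum dotp_simps dotp_section_vec)
    also have "\<dots> \<longleftrightarrow> ?R" using flow_in_cycle_space by (auto dest!: cycle_space_flow)
    finally show ?thesis .
  qed
  then show ?thesis by (simp add: indep_family_def)
qed

end

text \<open>Independence for one flow \<open>y\<close> suffices, since it is an open condition and
  therefore holds generically. No cycle matrix enters.\<close>

definition generic_matroid :: "'k::field itself \<Rightarrow> 'v set set" where
  "generic_matroid _ = {A. \<exists>y\<in>cycle_space tail head :: ('k ^ 'e) set.
    \<forall>c. (\<forall>z\<in>cycle_space tail head. (\<Sum>v\<in>A. c v * wedge v y z) = 0) \<longrightarrow> (\<forall>v\<in>A. c v = 0)}"

text \<open>There are finitely many independent sets to realize and finitely many edges, so one
  product of polynomials describes a nonempty open set of good hyperplanes.\<close>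

lemma generic_section:
  fixes Cyc :: "'k::field ^ 'e ^ 'g::finite"
  assumes inf: "infinite (UNIV :: 'k set)"
    and rows: "vec.span (rows Cyc) = cycle_space tail head"
    and card_g: "CARD('v) = 2 * CARD('g) - 2"
  shows "for_generic_hyperplane (\<lambda>H. distinct_points (section_point ends Cyc H) \<and>
    self_dual_matroid (CARD('g) - 1) UNIV (point_matroid (section_point ends Cyc H)) \<and>
    point_matroid (section_point ends Cyc H) = generic_matroid TYPE('k))"
proof -
  let ?M = "generic_matroid TYPE('k)"
  have flow: "(\<exists>y\<in>cycle_space tail head. P y) \<longleftrightarrow> (\<exists>h. P (h v* Cyc))" for P
    using flow_in_cycle_space[OF rows card_g] cycle_space_flow[OF rows card_g] by auto
  have M: "A \<in> ?M \<longleftrightarrow> (\<exists>h. indep_family (section_vec Cyc h) A)" for A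
    unfolding generic_matroid_def indep_family_section_vec[OF rows card_g] mem_Collect_eq
    by (rule flow)
  have "\<forall>A\<in>?M. \<exists>f. polynomial_map f \<and> (\<exists>h. f h \<noteq> 0) \<and>
    (\<forall>h. f h \<noteq> 0 \<longrightarrow> indep_family (section_vec Cyc h) A)"
  proof
    fix A assume "A \<in> ?M"
    then obtain h where "indep_family (section_vec Cyc h) A" using M by auto
    from indep_family_open[of "section_vec Cyc", OF polynomial_section_vec this]
    show "\<exists>f. polynomial_map f \<and> (\<exists>h. f h \<noteq> 0) \<and>
      (\<forall>h. f h \<noteq> 0 \<longrightarrow> indep_family (section_vec Cyc h) A)" by auto
  qed
  from bchoice[OF this] obtain f where
    f: "\<And>A. A \<in> ?M \<Longrightarrow> polynomial_map (f A)" "\<And>A. A \<in> ?M \<Longrightarrow> \<exists>h. f A h \<noteq> 0"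
    "\<And>A h. A \<in> ?M \<Longrightarrow> f A h \<noteq> 0 \<Longrightarrow> indep_family (section_vec Cyc h) A"
    by auto
  \<comment> \<open>\<open>g\<close> controls independence of all members of \<open>?M\<close> at
    once, \<open>k\<close> the absence of zeros of the flow.\<close>
  define g where "g h = (\<Prod>A\<in>?M. f A h)" for h
  define k where "k h = (\<Prod>e\<in>UNIV. (h v* Cyc) $ e)" for h
  have y: "polynomial_map (\<lambda>h. (h v* Cyc) $ e)" for e
    unfolding vector_matrix_mult_def vec_lambda_beta
    by (rule polynomial_map_sum, rule polynomial_map.mult, rule polynomial_map.coord,
        rule polynomial_map.const)
  have g: "polynomial_map g" unfolding g_def by (rule polynomial_map_prod) (rule f(1))
  have k: "polynomial_map k" unfolding k_def by (rule polynomial_map_prod) (rule y)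
  have "\<exists>a. g a \<noteq> 0"
    unfolding g_def by (rule polynomial_maps_prod_nonzero[OF inf finite f(1,2)])
  then obtain a where a: "g a \<noteq> 0" ..
  have y_nonzero: "\<exists>h. (h v* Cyc) $ e \<noteq> 0" for e
    using cycle_space_edge_nonzero[of e, where ?'k = 'k] flow[of "\<lambda>y. y $ e \<noteq> 0"] by auto
  have "\<exists>b. k b \<noteq> 0"
    unfolding k_def by (rule polynomial_maps_prod_nonzero[OF inf finite y y_nonzero])
  then obtain b where b: "k b \<noteq> 0" ..
  define U where "U = {h. g h * k h \<noteq> 0}"
  have "zariski_open U"
    unfolding zariski_open_def U_def using polynomial_map.mult[OF g k]
    by (intro exI[of _ "{\<lambda>h. g h * k h}"]) auto
  moreover have "U \<noteq> {}"
    using polynomial_maps_common_nonzero[OF inf g a k b] by (auto simp: U_def)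
  moreover have "\<forall>h\<in>U. h \<noteq> 0 \<and> distinct_points (section_point ends Cyc (hyperplane h)) \<and>
    self_dual_matroid (CARD('g) - 1) UNIV (point_matroid (section_point ends Cyc (hyperplane h))) \<and>
    point_matroid (section_point ends Cyc (hyperplane h)) = ?M"
  proof
    fix h assume "h \<in> U"
    then have nz: "\<And>e. (h v* Cyc) $ e \<noteq> 0" and fh: "\<And>A. A \<in> ?M \<Longrightarrow> f A h \<noteq> 0"
      by (auto simp: U_def g_def k_def)
    have "h \<noteq> 0" using nz by auto
    \<comment> \<open>The choice of \<open>U\<close> makes every member of \<open>?M\<close>
      independent at \<open>h\<close>; conversely \<open>h\<close> itself witnesses membership in
      \<open>?M\<close>.\<close>
    moreover have "{A. indep_family (section_vec Cyc h) A} = ?M" using fh f(3) M by auto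
    ultimately show "h \<noteq> 0 \<and> distinct_points (section_point ends Cyc (hyperplane h)) \<and>
      self_dual_matroid (CARD('g) - 1) UNIV (point_matroid (section_point ends Cyc (hyperplane h))) \<and>
      point_matroid (section_point ends Cyc (hyperplane h)) = ?M"
      using distinct_section_points[OF rows card_g nz] self_dual_section[OF rows card_g nz]
        point_matroid_section[OF rows card_g nz] by simp
  qed
  ultimately show ?thesis unfolding for_generic_hyperplane_def by (intro exI[of _ U] conjI)
qed

text \<open>A basis of the cycle space, indexed by \<open>'g\<close>, gives the rows. Without such a
  matrix the uniqueness claim below would range over a vacuous condition.\<close>

lemma cycle_matrix_exists:
  assumes card_g: "CARD('v) = 2 * CARD('g::finite) - 2"
  shows "\<exists>Cyc :: 'k::field ^ 'e ^ 'g. vec.span (rows Cyc) = cycle_space tail head"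
proof -
  let ?Z = "cycle_space tail head :: ('k ^ 'e) set"
  have dim: "vec.dim ?Z = CARD('g)" by (rule dim_cycle_space_eq[OF card_g])
  obtain B where B: "B \<subseteq> ?Z" "vec.independent B" "?Z \<subseteq> vec.span B" "card B = vec.dim ?Z"
    by (rule vec.basis_exists)
  have "finite B" using B(2) vec.finiteI_independent by blast
  then obtain r where r: "bij_betw r (UNIV :: 'g set) B"
    using B(4) dim finite_same_card_bij[of "UNIV :: 'g set" B] by auto
  define Cyc where "Cyc = (\<chi> i. r i)"
  have "rows Cyc = B" using r by (auto simp: rows_def row_def Cyc_def bij_betw_def vec_lambda_eta)
  moreover have "vec.span B = ?Z" using B subspace_cycle_space by (intro vec.span_subspace) auto
  ultimately show ?thesis by auto
qed

text \<open>Reversing edges only changes the signs of columns, which leaves the lines unchanged.\<close>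

lemma reorient_cycle_matrix:
  fixes Cyc :: "'k::field ^ 'e ^ 'g::finite"
  assumes "cycle_matrix ends Cyc"
  shows "\<exists>Cyc' :: 'k ^ 'e ^ 'g. vec.span (rows Cyc') = cycle_space tail head \<and>
    section_point ends Cyc' = section_point ends Cyc"
proof -
  obtain tail' head' where o: "orientation ends tail' head'"
    and rows: "vec.span (rows Cyc) = cycle_space tail' head'"
    using assms by (auto simp: cycle_matrix_def)
  \<comment> \<open>\<open>d e\<close> records whether the two orientations of \<open>e\<close>
    agree; scaling by \<open>d\<close> is an involution that exchanges the two cycle spaces.\<close>
  define d :: "'e \<Rightarrow> 'k" where "d e = (if head' e = head e then 1 else -1)" for e
  have d: "d e * d e = 1" "d e \<noteq> 0" for e by (auto simp: d_def)
  have "{tail' e, head' e} = {tail e, head e}" for e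
    using o ends[of e] by (simp add: orientation_def)
  then have flip: "tail' e = tail e \<and> head' e = head e \<or> tail' e = head e \<and> head' e = tail e" for e
    by (simp add: doubleton_eq_iff)
  have inc: "incidence_matrix tail' head' $ v $ e = sgn_at v e * d e" for v e
    using flip[of e]
  proof (elim disjE conjE)
    assume "tail' e = head e" "head' e = tail e"
    then show ?thesis
      using tail_neq_head[of e] by (simp add: incidence_matrix_def sgn_at_def d_def)
  qed (simp add: incidence_matrix_def sgn_at_def d_def)
  define D :: "'k ^ 'e \<Rightarrow> 'k ^ 'e" where "D x = (\<chi> e. d e * x $ e)" for x
  interpret D: Vector_Spaces.linear "(*s)" "(*s)" D
    by unfold_locales (simp_all add: D_def vec_eq_iff algebra_simps)
  have DD: "D (D x) = x" for x by (simp add: D_def vec_eq_iff mult.assoc[symmetric] d)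
  have mem: "x \<in> cycle_space tail' head' \<longleftrightarrow> D x \<in> cycle_space tail head" for x
    by (simp add: cycle_space_boundary boundary_def D_def cycle_space_def[of tail' head']
        matrix_vector_mult_def vec_eq_iff inc mult.assoc)
  have Z: "D ` cycle_space tail' head' = cycle_space tail head"
  proof (intro equalityI subsetI)
    fix x :: "'k ^ 'e" assume "x \<in> cycle_space tail head"
    then have "D x \<in> cycle_space tail' head'" using mem[of "D x"] DD[of x] by simp
    then show "x \<in> D ` cycle_space tail' head'" using DD[of x] by (intro image_eqI[of _ _ "D x"]) simp_all
  qed (use mem in auto)
  define Cyc' where "Cyc' = (\<chi> i. D (Cyc $ i))"
  have "rows Cyc' = D ` rows Cyc"
    by (auto simp: rows_def row_def Cyc'_def vec_lambda_eta)
  then have "vec.span (rows Cyc') = cycle_space tail head"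
    using D.span_image[of "rows Cyc"] rows Z by simp
  moreover have "graph_curve_line ends Cyc' v = graph_curve_line ends Cyc v" for v
  proof -
    have c: "column e Cyc' = d e *s column e Cyc" "column e Cyc = d e *s column e Cyc'" for e
      by (simp_all add: column_def Cyc'_def D_def vec_eq_iff mult.assoc[symmetric] d)
    show ?thesis unfolding graph_curve_line_def vec.span_eq
    proof (intro conjI subsetI)
      fix x assume "x \<in> {column e Cyc' |e. v \<in> ends e}"
      then obtain e where e: "v \<in> ends e" "x = column e Cyc'" by auto
      have "column e Cyc \<in> vec.span {column e Cyc |e. v \<in> ends e}"
        using e(1) by (intro vec.span_base) auto
      then show "x \<in> vec.span {column e Cyc |e. v \<in> ends e}"
        unfolding e(2) c(1)[of e] by (rule vec.span_scale)
    next
      fix x assume "x \<in> {column e Cyc |e. v \<in> ends e}"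
      then obtain e where e: "v \<in> ends e" "x = column e Cyc" by auto
      have "column e Cyc' \<in> vec.span {column e Cyc' |e. v \<in> ends e}"
        using e(1) by (intro vec.span_base) auto
      then show "x \<in> vec.span {column e Cyc' |e. v \<in> ends e}"
        unfolding e(2) c(2)[of e] by (rule vec.span_scale)
    qed
  qed
  then have "section_point ends Cyc' = section_point ends Cyc"
    by (simp add: section_point_def fun_eq_iff)
  ultimately show ?thesis by blast
qed

end

lemma oriented_cubic_graph_exists:
  fixes ends :: "'e::finite \<Rightarrow> 'v::finite set"
  assumes "graph ends" "trivalent ends" "three_connected ends"
  shows "\<exists>tail head e1 e2 e3. oriented_cubic_graph ends tail head e1 e2 e3"
proof -
  have "\<forall>e. \<exists>a b. ends e = {a, b}" using assms(1) unfolding graph_def card_2_iff by metis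
  then obtain tail head where "\<And>e. ends e = {tail e, head e}" by metis
  moreover have "\<forall>v. \<exists>a b c. {e. v \<in> ends e} = {a, b, c} \<and> a \<noteq> b \<and> a \<noteq> c \<and> b \<noteq> c"
    using assms(2) by (simp add: trivalent_def card_3_iff) metis
  then obtain e1 e2 e3 where
    "\<And>v. {e. v \<in> ends e} = {e1 v, e2 v, e3 v} \<and> e1 v \<noteq> e2 v \<and> e1 v \<noteq> e3 v \<and> e2 v \<noteq> e3 v"
    by metis
  ultimately have "oriented_cubic_graph ends tail head e1 e2 e3"
    using assms by unfold_locales (auto simp: orientation_def)
  then show ?thesis by blast
qed

theorem theorem5p5:
  fixes ends :: "'e::finite \<Rightarrow> 'v::finite set"
  assumes "infinite (UNIV :: 'k::field set)"
    and "graph ends" and "trivalent ends" and "three_connected ends"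
    and "CARD('v) = 2 * CARD('g::finite) - 2"
  shows "\<exists>!M. self_dual_matroid (CARD('g) - 1) (UNIV :: 'v set) M \<and>
    (\<forall>Cyc :: 'k ^ 'e ^ 'g. cycle_matrix ends Cyc \<longrightarrow>
      for_generic_hyperplane (\<lambda>H. distinct_points (section_point ends Cyc H) \<and>
        point_matroid (section_point ends Cyc H) = M))"
proof -
  obtain tail head e1 e2 e3 where "oriented_cubic_graph ends tail head e1 e2 e3"
    using oriented_cubic_graph_exists assms by blast
  then interpret oriented_cubic_graph ends tail head e1 e2 e3 .
  let ?M = "generic_matroid TYPE('k)"
  obtain C :: "'k ^ 'e ^ 'g" where C: "vec.span (rows C) = cycle_space tail head"
    using cycle_matrix_exists[OF assms(5)] by blast
  have cycC: "cycle_matrix ends C" using C orientation by (auto simp: cycle_matrix_def)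
  show ?thesis
  proof (rule ex1I[of _ ?M], intro conjI allI impI)
    show "self_dual_matroid (CARD('g) - 1) UNIV ?M"
      \<comment> \<open>Self-duality of \<open>?M\<close> does not mention the hyperplane, so a
        single good hyperplane is enough.\<close>
      using for_generic_hyperplane_common[OF assms(1) generic_section[OF assms(1) C assms(5)]
          generic_section[OF assms(1) C assms(5)]] by auto
  next
    fix Cyc :: "'k ^ 'e ^ 'g" assume "cycle_matrix ends Cyc"
    then obtain Cyc' :: "'k ^ 'e ^ 'g" where rows: "vec.span (rows Cyc') = cycle_space tail head"
      and eq: "section_point ends Cyc' = section_point ends Cyc"
      using reorient_cycle_matrix by blast
    show "for_generic_hyperplane (\<lambda>H. distinct_points (section_point ends Cyc H) \<and>
        point_matroid (section_point ends Cyc H) = ?M)"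
      using generic_section[OF assms(1) rows assms(5)] unfolding eq for_generic_hyperplane_def by blast
  next
    fix M assume "self_dual_matroid (CARD('g) - 1) UNIV M \<and>
      (\<forall>Cyc :: 'k ^ 'e ^ 'g. cycle_matrix ends Cyc \<longrightarrow>
        for_generic_hyperplane (\<lambda>H. distinct_points (section_point ends Cyc H) \<and>
          point_matroid (section_point ends Cyc H) = M))"
    then have "for_generic_hyperplane (\<lambda>H. distinct_points (section_point ends C H) \<and>
        point_matroid (section_point ends C H) = M)" using cycC by blast
    \<comment> \<open>Some hyperplane is good for both claims about \<open>C\<close>, and its point
      matroid equals both \<open>M\<close> and \<open>?M\<close>.\<close>
    from for_generic_hyperplane_common[OF assms(1) this generic_section[OF assms(1) C assms(5)]]
    show "M = ?M" by auto
  qed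
qed

end
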